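(* Fix an interval $J\subseteq\mathbb R$, $t_0\in J$, $y\in V$, and let $(X,\mathbb X^2)$ be a rough path on $J$, i.e. $X\in\mathcal C^\gamma(J,V)$, $\mathbb X^2\in\Omega\mathcal C^{2\gamma}(J,V\otimes V)$ and $N\mathbb X^{2,\mu\nu}_{sut}=\delta X^\mu_{su}\,\delta X^\nu_{ut}$ for all $s,u,t\in J$. If $\gamma>1/3$ and $\varphi\in C^{1,\delta}(V,V\otimes V^* )$ with $\delta\in(0,1)$ and $(2+\delta)\gamma>1$, there exists a path $Y\in\mathcal D_X^{\gamma,2\gamma}(J,V)$ which solves the differential equation $dY^\mu_t=\varphi(Y_t)^\mu_\nu\,dX^\nu_t$, $Y_{t_0}=y$, in $J$, i.e. such that $$Y^\mu_t=y^\mu+\int_{t_0}^t\varphi(Y_u)^\mu_\nu\,dX^\nu_u\qquad\text{for every }t\in J,$$ where the integral is the rough integral based on the couple $(X,\mathbb X^2)$.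
   Context: $V$ is a finite-dimensional vector space; repeated indices are summed; the exponent $\delta$ is not to be confused with the increment operator $\delta f_{st}:=f_t-f_s$. $\mathcal C^\gamma(J,U)$: bounded continuous $f:J\to U$ with $\|f\|_{\gamma,J}:=\sup_{s\ne t}|f_t-f_s|/|t-s|^\gamma<\infty$. $\Omega\mathcal C(J,U)$: bounded continuous $R:J^2\to U$ with $R_{tt}=0$; $\|R\|_{\gamma,J}:=\sup_{s\neq t}|R_{st}|/|t-s|^\gamma$; $\Omega\mathcal C^\gamma(J,U)$: those with $\|R\|_{\gamma,J}<\infty$. $(NR)_{sut}:=R_{st}-R_{ut}-R_{su}$. For a path $f$, $(fR)_{st}=f_sR_{st}$. $C^{1,\delta}(V,U)$: differentiable maps $\varphi:V\to U$ with $\delta$-Hölder derivative, with norm $\|\varphi\|_{1,\delta}=\sup|\varphi|+\sup|\partial\varphi|+\sup_{x\ne y}|\partial\varphi(x)-\partial\varphi(y)|/|x-y|^\delta$. For $\eta>\gamma$, $\mathcal D_X^{\gamma,\eta}(J,U)$ is the space of pairs $(Y,Y')$ (often denoted just $Y$) with $Y\in\mathcal C^\gamma(J,U)$, $Y'\in\mathcal C^{\eta-\gamma}(J,U\otimes V^* )$ and $\delta Y^\mu=Y'^{\,\mu}_\nu\,\delta X^\nu+R_Y^\mu$ with $R_Y\in\Omega\mathcal C^\eta(J,U)$. Rough integral: if $W\in\mathcal D_X^{\gamma,\eta}(J,V\otimes V^* )$ with $\eta+\gamma>1$ and $\delta W^\mu_\nu=W'^{\,\mu}_{\kappa\nu}\,\delta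 X^\kappa+R^\mu_{W,\nu}$, then $\int_s^tW^\mu_{\nu,u}\,dX^\nu_u:=W^\mu_{\nu,s}\,\delta X^\nu_{st}+W'^{\,\mu}_{\kappa\nu,s}\,\mathbb X^{2,\kappa\nu}_{st}-Q^\mu_{st}$, where $Q$ is the unique element of $\Omega\mathcal C^{\eta+\gamma}(J,V)$ with $NQ^\mu=N(W^\mu_\nu\,\delta X^\nu+W'^{\,\mu}_{\kappa\nu}\,\mathbb X^{2,\kappa\nu})$. Here $W=\varphi(Y)\in\mathcal D_X^{\gamma,(1+\delta)\gamma}(J,V\otimes V^* )$ with $W'^{\,\mu}_{\kappa\nu}=\partial_\rho\varphi(Y)^\mu_\nu\,Y'^{\,\rho}_\kappa$. Solutions are fixed points $Y=G(Y)$ of the map $G(Y)_t=Y_{t_0}+\int_{t_0}^t\varphi(Y_u)\,dX_u$ on $\mathcal D_X^{\gamma,2\gamma}$, where $G(Y)$ carries the derivative $G(Y)'=\varphi(Y)$.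
   Formalization: For unbounded J the claim fails as stated (solutions can be unbounded on J), so one path Y on J is shown to lie in the controlled-path space and to solve the equation on every bounded interval K in J containing t_0; for bounded J, K = J gives the full claim. *)

theory Defs
  imports "HOL-Analysis.Analysis"
begin

text \<open>
  The space \<open>V\<close> is \<open>real ^ 'n\<close>. For a normed space \<open>U\<close> the tensor product \<open>U \<otimes> V\<^sup>*\<close> is rendered
  as the space of linear maps \<open>(real ^ 'n) \<Rightarrow>\<^sub>L U\<close>, so that \<open>Y'\<^sup>\<mu>\<^sub>\<nu> v\<^sup>\<nu>\<close> is \<open>Y' v\<close>. An element \<open>A\<close> of
  \<open>V \<otimes> V\<close> is the array of its coordinates, \<open>A\<^sup>\<kappa>\<^sup>\<nu> = A $ \<kappa> $ \<nu>\<close>. All norms on these spaces are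
  equivalent, so the Hoelder spaces below do not depend on the choice of norm.
\<close>

definition increment :: "(real \<Rightarrow> 'a::ab_group_add) \<Rightarrow> real \<Rightarrow> real \<Rightarrow> 'a" where
  "increment f s t = f t - f s"

definition additivity_defect ::
    "(real \<Rightarrow> real \<Rightarrow> 'a::ab_group_add) \<Rightarrow> real \<Rightarrow> real \<Rightarrow> real \<Rightarrow> 'a" where
  "additivity_defect R s u t = R s t - R u t - R s u"

text \<open>Finiteness of a supremum of nonnegative quotients is expressed by \<^const>\<open>bdd_above\<close>.\<close>

definition holder_space :: "real \<Rightarrow> real set \<Rightarrow> (real \<Rightarrow> 'a::real_normed_vector) set" where
  "holder_space \<gamma> J = {f. continuous_on J f \<and> bounded (f ` J) \<and>
     bdd_above {norm (f t - f s) / \<bar>t - s\<bar> powr \<gamma> | s t. s \<in> J \<and> t \<in> J \<and> s \<noteq> t}}"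

definition two_param_holder_space ::
    "real \<Rightarrow> real set \<Rightarrow> (real \<Rightarrow> real \<Rightarrow> 'a::real_normed_vector) set" where
  "two_param_holder_space \<gamma> J = {R. continuous_on (J \<times> J) (\<lambda>(s, t). R s t) \<and>
     bounded ((\<lambda>(s, t). R s t) ` (J \<times> J)) \<and> (\<forall>t\<in>J. R t t = 0) \<and>
     bdd_above {norm (R s t) / \<bar>t - s\<bar> powr \<gamma> | s t. s \<in> J \<and> t \<in> J \<and> s \<noteq> t}}"

definition rough_path ::
    "real \<Rightarrow> real set \<Rightarrow> (real \<Rightarrow> real ^ 'n) \<Rightarrow> (real \<Rightarrow> real \<Rightarrow> real ^ 'n ^ 'n) \<Rightarrow> bool" where
  "rough_path \<gamma> J X XX \<longleftrightarrow>
     X \<in> holder_space \<gamma> J \<and> XX \<in> two_param_holder_space (2 * \<gamma>) J \<and>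
     (\<forall>s\<in>J. \<forall>u\<in>J. \<forall>t\<in>J. \<forall>\<mu> \<nu>.
        additivity_defect XX s u t $ \<mu> $ \<nu> = increment X s u $ \<mu> * increment X u t $ \<nu>)"

definition controlled_paths ::
    "real \<Rightarrow> real \<Rightarrow> real set \<Rightarrow> (real \<Rightarrow> real ^ 'n) \<Rightarrow>
     ((real \<Rightarrow> 'u::real_normed_vector) \<times> (real \<Rightarrow> (real ^ 'n) \<Rightarrow>\<^sub>L 'u)) set" where
  "controlled_paths \<gamma> \<eta> J X = {(Y, Y').
     Y \<in> holder_space \<gamma> J \<and> Y' \<in> holder_space (\<eta> - \<gamma>) J \<and>
     (\<lambda>s t. increment Y s t - blinfun_apply (Y' s) (increment X s t))
       \<in> two_param_holder_space \<eta> J}"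

text \<open>The contraction \<open>B\<^sub>\<kappa>\<^sub>\<nu> A\<^sup>\<kappa>\<^sup>\<nu>\<close>, where \<open>\<kappa>\<close> is the index of the first argument of \<open>B\<close>.\<close>

definition contract ::
    "((real ^ 'n) \<Rightarrow>\<^sub>L (real ^ 'n) \<Rightarrow>\<^sub>L 'u::real_normed_vector) \<Rightarrow> real ^ 'n ^ 'n \<Rightarrow> 'u" where
  "contract B A = (\<Sum>\<kappa>\<in>UNIV. \<Sum>\<nu>\<in>UNIV.
     (A $ \<kappa> $ \<nu>) *\<^sub>R blinfun_apply (blinfun_apply B (axis \<kappa> 1)) (axis \<nu> 1))"

definition rough_germ ::
    "(real \<Rightarrow> real ^ 'n) \<Rightarrow> (real \<Rightarrow> real \<Rightarrow> real ^ 'n ^ 'n) \<Rightarrow>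
     (real \<Rightarrow> (real ^ 'n) \<Rightarrow>\<^sub>L 'u::real_normed_vector) \<Rightarrow>
     (real \<Rightarrow> (real ^ 'n) \<Rightarrow>\<^sub>L (real ^ 'n) \<Rightarrow>\<^sub>L 'u) \<Rightarrow> real \<Rightarrow> real \<Rightarrow> 'u" where
  "rough_germ X XX W W' s t =
     blinfun_apply (W s) (increment X s t) + contract (W' s) (XX s t)"

text \<open>
  The description is applied to the value of the integral and not to the remainder \<open>Q\<close>, because
  \<open>Q\<close> is unique only as a function on \<open>J \<times> J\<close>. It is meaningful when \<open>J\<close> is an interval containing
  \<open>s\<close> and \<open>t\<close>, \<open>(W, W') \<in> controlled_paths \<gamma> \<eta> J X\<close>, \<open>\<eta> + \<gamma> > 1\<close> and such a \<open>Q\<close> exists.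
\<close>

definition rough_integral ::
    "real \<Rightarrow> real \<Rightarrow> real set \<Rightarrow> (real \<Rightarrow> real ^ 'n) \<Rightarrow> (real \<Rightarrow> real \<Rightarrow> real ^ 'n ^ 'n) \<Rightarrow>
     (real \<Rightarrow> (real ^ 'n) \<Rightarrow>\<^sub>L 'u::real_normed_vector) \<times>
     (real \<Rightarrow> (real ^ 'n) \<Rightarrow>\<^sub>L (real ^ 'n) \<Rightarrow>\<^sub>L 'u) \<Rightarrow> real \<Rightarrow> real \<Rightarrow> 'u" where
  "rough_integral \<gamma> \<eta> J X XX = (\<lambda>(W, W') s t. THE I.
     \<exists>Q \<in> two_param_holder_space (\<eta> + \<gamma>) J.
       (\<forall>a\<in>J. \<forall>b\<in>J. \<forall>c\<in>J.
          additivity_defect Q a b c = additivity_defect (rough_germ X XX W W') a b c) \<and>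
       I = rough_germ X XX W W' s t - Q s t)"

definition total_derivative ::
    "('a::real_normed_vector \<Rightarrow> 'b::real_normed_vector) \<Rightarrow> 'a \<Rightarrow> 'a \<Rightarrow>\<^sub>L 'b" where
  "total_derivative \<phi> x = Blinfun (frechet_derivative \<phi> (at x))"

definition C1_holder_space ::
    "real \<Rightarrow> ('a::real_normed_vector \<Rightarrow> 'b::real_normed_vector) set" where
  "C1_holder_space \<delta> = {\<phi>. (\<forall>x. \<phi> differentiable (at x)) \<and>
     bounded (range \<phi>) \<and> bounded (range (total_derivative \<phi>)) \<and>
     bdd_above {norm (total_derivative \<phi> x - total_derivative \<phi> y) / norm (x - y) powr \<delta>
       | x y. x \<noteq> y}}"

text \<open>
  In coordinates the second component is \<open>W'\<^sup>\<mu>\<^sub>\<kappa>\<^sub>\<nu> = \<partial>\<^sub>\<rho>\<phi>(Y)\<^sup>\<mu>\<^sub>\<nu> Y'\<^sup>\<rho>\<^sub>\<kappa>\<close>, with \<open>\<kappa>\<close> the index of the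
  first argument, as \<^const>\<open>contract\<close> expects.
\<close>

definition controlled_compose ::
    "((real ^ 'n) \<Rightarrow> 'u::real_normed_vector) \<Rightarrow>
     (real \<Rightarrow> real ^ 'n) \<times> (real \<Rightarrow> (real ^ 'n) \<Rightarrow>\<^sub>L (real ^ 'n)) \<Rightarrow>
     (real \<Rightarrow> 'u) \<times> (real \<Rightarrow> (real ^ 'n) \<Rightarrow>\<^sub>L 'u)" where
  "controlled_compose \<phi> = (\<lambda>(Y, Y').
     (\<lambda>t. \<phi> (Y t), \<lambda>t. total_derivative \<phi> (Y t) o\<^sub>L Y' t))"

text \<open>
  A solution is a fixed point in the space of controlled paths, hence carries the derivative
  \<open>Y' = \<phi>(Y)\<close>. Membership of the integrand in its space of controlled paths is included so that
  the rough integral is the one given by the sewing argument and not an arbitrary value.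
\<close>

definition rde_solution ::
    "real \<Rightarrow> real \<Rightarrow> real set \<Rightarrow> (real \<Rightarrow> real ^ 'n) \<Rightarrow> (real \<Rightarrow> real \<Rightarrow> real ^ 'n ^ 'n) \<Rightarrow>
     ((real ^ 'n) \<Rightarrow> (real ^ 'n) \<Rightarrow>\<^sub>L (real ^ 'n)) \<Rightarrow> real \<Rightarrow> real ^ 'n \<Rightarrow>
     (real \<Rightarrow> real ^ 'n) \<Rightarrow> (real \<Rightarrow> (real ^ 'n) \<Rightarrow>\<^sub>L (real ^ 'n)) \<Rightarrow> bool" where
  "rde_solution \<gamma> \<delta> J X XX \<phi> t0 y Y Y' \<longleftrightarrow>
     (Y, Y') \<in> controlled_paths \<gamma> (2 * \<gamma>) J X \<and>
     (\<forall>t\<in>J. Y' t = \<phi> (Y t)) \<and>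
     controlled_compose \<phi> (Y, Y') \<in> controlled_paths \<gamma> ((1 + \<delta>) * \<gamma>) J X \<and>
     (\<forall>t\<in>J. Y t = y + rough_integral \<gamma> ((1 + \<delta>) * \<gamma>) J X XX (controlled_compose \<phi> (Y, Y')) t0 t)"

end

theory Submission
  imports Defs
begin

text \<open>
  The solution is a limit of Euler schemes. Write \<open>\<psi>(x) = \<partial>\<phi>(x) \<phi>(x)\<close>. Freezing the fields at time
  \<open>s\<close> gives the second order expansion \<open>\<phi>(Y\<^sub>s) \<delta>X\<^sub>s\<^sub>t + \<psi>(Y\<^sub>s) XX\<^sub>s\<^sub>t\<close> of a solution on \<open>[s, t]\<close>, and the
  expansion error \<open>E\<^sub>s\<^sub>t\<close> of a path is the difference between \<open>\<delta>Y\<^sub>s\<^sub>t\<close> and this expansion. A path with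
  \<open>E\<^sub>s\<^sub>t = O(\<bar>t - s\<bar>\<^sup>\<theta>)\<close> for \<open>\<theta> = (2 + \<delta>)\<gamma> > 1\<close> is a solution: \<open>-E\<close> is then exactly the remainder
  \<open>Q\<close> that defines the rough integral of \<open>\<phi>(Y)\<close>, and it is the only one because an additive function
  that is \<open>O(\<bar>t - s\<bar>\<^sup>\<theta>)\<close> with \<open>\<theta> > 1\<close> has zero derivative (\<open>rough_integral_eqI\<close>,
  \<open>expansion_error_small_imp_solution\<close>).

  Such a path is found by Davie's argument. Chen's relation and a Taylor expansion of \<open>\<phi>\<close> show that
  \<open>E\<^sub>s\<^sub>t - E\<^sub>s\<^sub>u - E\<^sub>u\<^sub>t\<close> is of order \<open>\<theta>\<close>, with a constant that does not depend on the size of \<open>E\<close> as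
  soon as \<open>\<bar>E\<^sub>s\<^sub>u\<bar> \<le> \<bar>u - s\<bar>\<^sup>2\<^sup>\<gamma>\<close> (\<open>expansion_error_almost_additive\<close>). An Euler scheme on a finite set of
  times has \<open>E = 0\<close> between neighbours. Splitting an interval near its midpoint, where \<open>\<theta> > 1\<close> makes
  twice the halved bound smaller than the bound itself, propagates \<open>\<bar>E\<^sub>s\<^sub>t\<bar> \<le> L \<bar>t - s\<bar>\<^sup>\<theta>\<close> from neighbours to
  all pairs at distance at most \<open>h\<close>, with \<open>L\<close> and \<open>h\<close> independent of the set of times
  (\<open>davie_estimate\<close>). Boundedness of \<open>\<phi>\<close> and \<open>\<partial>\<phi>\<close> keeps the scheme within an a priori bound, so
  there is no explosion in finite time.

  The limit is taken by compactness: each inequality \<open>\<bar>E\<^sub>s\<^sub>t\<bar> \<le> L \<bar>t - s\<bar>\<^sup>\<theta>\<close>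
  is a closed condition on \<open>Y\<close> in the topology of pointwise convergence, finitely many of them hold
  for an Euler scheme, and Tychonoff's theorem yields one path satisfying all of them
  (\<open>forward_path\<close>). Times before \<open>t0\<close> are treated by reversing time (\<open>two_sided_path\<close>).
\<close>

section \<open>Contraction with the second level and Chen's relation\<close>

lemma contract_tensor:
  fixes B :: "(real ^ 'n) \<Rightarrow>\<^sub>L (real ^ 'n) \<Rightarrow>\<^sub>L 'u::real_normed_vector"
  shows "contract B (\<chi> i j. a $ i * b $ j) = B a b"
proof -
  have lin: "linear f \<Longrightarrow> f x = (\<Sum>i\<in>UNIV. x $ i *\<^sub>R f (axis i 1))"
    for f :: "real ^ 'n \<Rightarrow> 'w::real_vector" and x
    by (subst basis_expansion[of x, symmetric, folded scalar_mult_eq_scaleR])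
       (simp add: linear_sum linear_scale scalar_mult_eq_scaleR)
  have "B a b = (\<Sum>i\<in>UNIV. a $ i *\<^sub>R blinfun_apply B (axis i 1)) b"
    by (subst lin[of "blinfun_apply B"]) (auto intro: bounded_linear.linear blinfun.bounded_linear_right)
  also have "\<dots> = (\<Sum>i\<in>UNIV. a $ i *\<^sub>R blinfun_apply B (axis i 1) b)"
    by (simp add: blinfun.sum_left blinfun.scaleR_left)
  also have "\<dots> = (\<Sum>i\<in>UNIV. a $ i *\<^sub>R (\<Sum>j\<in>UNIV. b $ j *\<^sub>R blinfun_apply (blinfun_apply B (axis i 1)) (axis j 1)))"
    by (intro sum.cong refl arg_cong2[where f="(*\<^sub>R)"] lin)
       (auto intro: bounded_linear.linear blinfun.bounded_linear_right)
  finally show ?thesis by (simp add: contract_def scaleR_sum_right)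
qed

lemma bounded_bilinear_contract:
  "bounded_bilinear (contract :: _ \<Rightarrow> real ^ 'n ^ 'n \<Rightarrow> 'u::real_normed_vector)"
proof
  show "\<exists>K. \<forall>B A. norm (contract B A :: 'u) \<le> norm B * norm (A :: real ^ 'n ^ 'n) * K"
  proof (intro exI allI)
    fix B :: "(real ^ 'n) \<Rightarrow>\<^sub>L (real ^ 'n) \<Rightarrow>\<^sub>L 'u" and A :: "real ^ 'n ^ 'n"
    have "norm (A $ i $ j *\<^sub>R B (axis i 1) (axis j 1)) \<le> norm B * norm A" for i j
    proof -
      have "\<bar>A $ i $ j\<bar> \<le> norm A"
        using component_le_norm_cart[of "A $ i" j] Finite_Cartesian_Product.norm_nth_le[of A i] by simp
      moreover have "norm (B (axis i 1) (axis j 1)) \<le> norm B"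
        using norm_blinfun[of "B (axis i 1)" "axis j 1"] norm_blinfun[of B "axis i 1"] by simp
      ultimately show ?thesis
        by (simp add: mult_mono mult.commute[of "norm B"])
    qed
    then have "norm (contract B A) \<le> (\<Sum>i\<in>(UNIV::'n set). \<Sum>j\<in>(UNIV::'n set). norm B * norm A)"
      unfolding contract_def by (intro sum_norm_le)
    then show "norm (contract B A) \<le> norm B * norm A * (real CARD('n) * real CARD('n))"
      by (simp add: mult_ac)
  qed
qed (simp_all add: contract_def blinfun.add_left blinfun.scaleR_left algebra_simps
       sum.distrib scaleR_sum_right)

text \<open>
  The linear part of the germ fails to be additive by \<open>\<delta>W\<^sub>s\<^sub>u \<delta>X\<^sub>u\<^sub>t\<close>. Chen's relation makes the second
  level contribute \<open>W'\<^sub>s \<delta>X\<^sub>s\<^sub>u \<delta>X\<^sub>u\<^sub>t\<close> with the opposite sign, so that only the remainder of \<open>W\<close> as a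
  controlled path and the variation of \<open>W'\<close> against the second level are left.
\<close>

lemma additivity_defect_rough_germ:
  assumes chen: "\<And>\<mu> \<nu>. additivity_defect XX s u t $ \<mu> $ \<nu>
      = increment X s u $ \<mu> * increment X u t $ \<nu>"
  shows "additivity_defect (rough_germ X XX W W') s u t =
      - (increment W s u - W' s (increment X s u)) (increment X u t)
      - contract (increment W' s u) (XX u t)"
proof -
  interpret contract: bounded_bilinear contract by (rule bounded_bilinear_contract)
  have "additivity_defect XX s u t = (\<chi> i j. increment X s u $ i * increment X u t $ j)"
    by (simp add: vec_eq_iff chen)
  then have "contract (W' s) (additivity_defect XX s u t) = W' s (increment X s u) (increment X u t)"
    by (simp add: contract_tensor)
  then have *: "contract (W' s) (XX s t) = contract (W' s) (XX u t) + contract (W' s) (XX s u)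
       + W' s (increment X s u) (increment X u t)"
    by (simp add: additivity_defect_def contract.diff_right contract.add_right algebra_simps)
  have "increment X s t = increment X s u + increment X u t" by (simp add: increment_def)
  then show ?thesis
    by (simp add: additivity_defect_def rough_germ_def * contract.diff_left increment_def[of W]
      increment_def[of W'] blinfun.add_right blinfun.diff_left blinfun.add_left algebra_simps)
qed

section \<open>Hoelder spaces and characterization of the rough integral\<close>

text \<open>
  Additivity turns the bound into \<open>\<bar>D\<^sub>s\<^sub>v - D\<^sub>s\<^sub>u\<bar> \<le> C \<bar>v - u\<bar>\<^sup>\<theta>\<close>, hence \<open>D\<^sub>s\<close> has derivative zero. This is
  what makes the remainder in the definition of the rough integral unique.
\<close>

lemma additive_holder_imp_zero:
  fixes D :: "real \<Rightarrow> real \<Rightarrow> 'a::real_normed_vector"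
  assumes K: "is_interval K" and \<theta>: "\<theta> > 1"
    and add: "\<And>a b c. a \<in> K \<Longrightarrow> b \<in> K \<Longrightarrow> c \<in> K \<Longrightarrow> D a c = D b c + D a b"
    and bd: "\<And>a b. a \<in> K \<Longrightarrow> b \<in> K \<Longrightarrow> norm (D a b) \<le> C * \<bar>b - a\<bar> powr \<theta>"
    and st: "s \<in> K" "t \<in> K"
  shows "D s t = 0"
proof -
  have "(D s has_derivative (\<lambda>h. 0)) (at u within K)" if u: "u \<in> K" for u
  proof (unfold has_derivative_within, intro conjI)
    have lim: "((\<lambda>v. C * \<bar>v - u\<bar> powr (\<theta> - 1)) \<longlongrightarrow> 0) (at u within K)"
      using \<theta> by (auto intro!: tendsto_eq_intros)
    have "norm ((1 / norm (v - u)) *\<^sub>R (D s v - (D s u + 0))) \<le> C * \<bar>v - u\<bar> powr (\<theta> - 1)"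
      if "v \<in> K" "v \<noteq> u" for v
    proof -
      have "norm (D s v - D s u) \<le> C * \<bar>v - u\<bar> powr \<theta>"
        using add[OF st(1) u \<open>v \<in> K\<close>] bd[OF u \<open>v \<in> K\<close>] by simp
      then show ?thesis using that by (simp add: powr_diff divide_right_mono)
    qed
    then show "((\<lambda>v. (1 / norm (v - u)) *\<^sub>R (D s v - (D s u + 0))) \<longlongrightarrow> 0) (at u within K)"
      by (intro tendsto_0_le[OF lim, of _ 1])
         (auto simp: eventually_at_filter intro!: always_eventually order_trans[OF _ abs_ge_self])
  qed auto
  moreover have "convex K" using K by (simp add: is_interval_convex_1)
  moreover have "D s s = 0" using add[OF st(1) st(1) st(1)] by simp
  ultimately show ?thesis
    using has_derivative_zero_constant[of K "D s"] st by force
qed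

lemma holder_quotient_bound:
  assumes "bdd_above {norm (f s t) / \<bar>t - s\<bar> powr \<gamma> | s t. s \<in> K \<and> t \<in> K \<and> s \<noteq> (t::real)}"
  obtains C where "\<And>s t. s \<in> K \<Longrightarrow> t \<in> K \<Longrightarrow> s \<noteq> t \<Longrightarrow> norm (f s t) \<le> C * \<bar>t - s\<bar> powr \<gamma>"
proof -
  obtain C where C: "\<And>x. x \<in> {norm (f s t) / \<bar>t - s\<bar> powr \<gamma> | s t. s \<in> K \<and> t \<in> K \<and> s \<noteq> t} \<Longrightarrow> x \<le> C"
    using assms unfolding bdd_above_def by blast
  have "norm (f s t) \<le> C * \<bar>t - s\<bar> powr \<gamma>" if "s \<in> K" "t \<in> K" "s \<noteq> t" for s t
  proof -
    have "norm (f s t) / \<bar>t - s\<bar> powr \<gamma> \<le> C" using that by (intro C) auto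
    then show ?thesis using that by (simp add: divide_le_eq)
  qed
  then show ?thesis using that by blast
qed

lemma two_param_holder_space_bound:
  assumes "R \<in> two_param_holder_space \<gamma> K"
  obtains C where "\<And>s t. s \<in> K \<Longrightarrow> t \<in> K \<Longrightarrow> norm (R s t) \<le> C * \<bar>t - s\<bar> powr \<gamma>"
proof -
  have "bdd_above {norm (R s t) / \<bar>t - s\<bar> powr \<gamma> | s t. s \<in> K \<and> t \<in> K \<and> s \<noteq> t}"
    and "\<forall>t\<in>K. R t t = 0"
    using assms by (auto simp: two_param_holder_space_def)
  then obtain C where "norm (R s t) \<le> C * \<bar>t - s\<bar> powr \<gamma>" if "s \<in> K" "t \<in> K" "s \<noteq> t" for s t
    using holder_quotient_bound[of R] by blast
  then have "norm (R s t) \<le> C * \<bar>t - s\<bar> powr \<gamma>" if "s \<in> K" "t \<in> K" for s t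
    using that \<open>\<forall>t\<in>K. R t t = 0\<close> by (cases "s = t") auto
  then show ?thesis by (rule that)
qed

lemma holder_space_bound:
  assumes "f \<in> holder_space \<gamma> K"
  obtains C where "\<And>s t. s \<in> K \<Longrightarrow> t \<in> K \<Longrightarrow> norm (f t - f s) \<le> C * \<bar>t - s\<bar> powr \<gamma>"
proof -
  have "bdd_above {norm (f t - f s) / \<bar>t - s\<bar> powr \<gamma> | s t. s \<in> K \<and> t \<in> K \<and> s \<noteq> t}"
    using assms by (auto simp: holder_space_def)
  then obtain C where "norm (f t - f s) \<le> C * \<bar>t - s\<bar> powr \<gamma>" if "s \<in> K" "t \<in> K" "s \<noteq> t" for s t
    using holder_quotient_bound[of "\<lambda>s t. f t - f s"] by blast
  then have "norm (f t - f s) \<le> C * \<bar>t - s\<bar> powr \<gamma>" if "s \<in> K" "t \<in> K" for s t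
    using that by (cases "s = t") auto
  then show ?thesis by (rule that)
qed

text \<open>
  To compute a rough integral it suffices to guess its primitive \<open>Z\<close>: increments are additive, so the
  germ minus \<open>\<delta>Z\<close> has the defect of the germ, and it is the remainder once it has the right order.
\<close>

lemma rough_integral_eqI:
  fixes Z :: "real \<Rightarrow> 'u::real_normed_vector"
  assumes K: "is_interval K" and "\<eta> + \<gamma> > 1"
    and Q: "(\<lambda>a b. rough_germ X XX W W' a b - increment Z a b) \<in> two_param_holder_space (\<eta> + \<gamma>) K"
    and st: "s \<in> K" "t \<in> K"
  shows "rough_integral \<gamma> \<eta> K X XX (W, W') s t = increment Z s t"
proof -
  let ?G = "rough_germ X XX W W'" and ?Q = "\<lambda>a b. rough_germ X XX W W' a b - increment Z a b"
  have defect: "additivity_defect ?Q a b c = additivity_defect ?G a b c" for a b c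
    by (simp add: additivity_defect_def increment_def)
  have uniq: "?Q s t = Q' s t"
    if Q': "Q' \<in> two_param_holder_space (\<eta> + \<gamma>) K"
      and "\<forall>a\<in>K. \<forall>b\<in>K. \<forall>c\<in>K. additivity_defect Q' a b c = additivity_defect ?G a b c" for Q'
  proof -
    obtain C where C: "\<And>s t. s \<in> K \<Longrightarrow> t \<in> K \<Longrightarrow> norm (?Q s t) \<le> C * \<bar>t - s\<bar> powr (\<eta> + \<gamma>)"
      using two_param_holder_space_bound[OF Q] by blast
    obtain C' where C': "\<And>s t. s \<in> K \<Longrightarrow> t \<in> K \<Longrightarrow> norm (Q' s t) \<le> C' * \<bar>t - s\<bar> powr (\<eta> + \<gamma>)"
      using two_param_holder_space_bound[OF Q'] by blast
    have "?Q s t - Q' s t = 0"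
    proof (rule additive_holder_imp_zero[OF K \<open>\<eta> + \<gamma> > 1\<close> _ _ st, where D = "\<lambda>s t. ?Q s t - Q' s t"])
      fix a b c assume abc: "a \<in> K" "b \<in> K" "c \<in> K"
      then have "additivity_defect Q' a b c = additivity_defect ?Q a b c"
        using that(2) by (simp add: defect)
      then show "?Q a c - Q' a c = (?Q b c - Q' b c) + (?Q a b - Q' a b)"
        by (simp add: additivity_defect_def algebra_simps)
    next
      fix a b assume ab: "a \<in> K" "b \<in> K"
      show "norm (?Q a b - Q' a b) \<le> (C + C') * \<bar>b - a\<bar> powr (\<eta> + \<gamma>)"
        using C[OF ab] C'[OF ab] norm_triangle_ineq4[of "?Q a b" "Q' a b"]
        by (simp add: algebra_simps)
    qed
    then show ?thesis by simp
  qed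
  show ?thesis
    unfolding rough_integral_def prod.case
  proof (rule the_equality)
    show "\<exists>Q\<in>two_param_holder_space (\<eta> + \<gamma>) K.
       (\<forall>a\<in>K. \<forall>b\<in>K. \<forall>c\<in>K. additivity_defect Q a b c = additivity_defect ?G a b c) \<and>
       increment Z s t = ?G s t - Q s t"
      by (rule bexI[OF _ Q]) (simp add: defect)
    fix I assume "\<exists>Q\<in>two_param_holder_space (\<eta> + \<gamma>) K.
       (\<forall>a\<in>K. \<forall>b\<in>K. \<forall>c\<in>K. additivity_defect Q a b c = additivity_defect ?G a b c) \<and>
       I = ?G s t - Q s t"
    then obtain Q where "Q \<in> two_param_holder_space (\<eta> + \<gamma>) K"
      and "\<forall>a\<in>K. \<forall>b\<in>K. \<forall>c\<in>K. additivity_defect Q a b c = additivity_defect ?G a b c"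
      and "I = ?G s t - Q s t" by blast
    with uniq[of Q] show "I = increment Z s t" by (simp add: algebra_simps)
  qed
qed

text \<open>
  For bounded functions a Hoelder condition only concerns nearby points. All estimates on paths below
  hold at small distances, and this lemma makes them global.
\<close>

lemma local_holder_imp_bdd_above:
  fixes R :: "real \<Rightarrow> real \<Rightarrow> 'a::real_normed_vector"
  assumes bd: "\<And>s t. s \<in> K \<Longrightarrow> t \<in> K \<Longrightarrow> norm (R s t) \<le> B" and "h > 0" "\<eta> > 0" "C \<ge> 0"
    and loc: "\<And>s t. s \<in> K \<Longrightarrow> t \<in> K \<Longrightarrow> \<bar>t - s\<bar> \<le> h \<Longrightarrow> norm (R s t) \<le> C * \<bar>t - s\<bar> powr \<eta>"
  shows "bdd_above {norm (R s t) / \<bar>t - s\<bar> powr \<eta> | s t. s \<in> K \<and> t \<in> K \<and> s \<noteq> t}"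
proof (rule bdd_aboveI[where M = "C + B / h powr \<eta>"], safe)
  fix s t assume st: "s \<in> K" "t \<in> K" "s \<noteq> t"
  have "B \<ge> 0" using bd[OF st(1,1)] norm_ge_zero order_trans by blast
  show "norm (R s t) / \<bar>t - s\<bar> powr \<eta> \<le> C + B / h powr \<eta>"
  proof (cases "\<bar>t - s\<bar> \<le> h")
    case True
    then have "norm (R s t) / \<bar>t - s\<bar> powr \<eta> \<le> C" using loc[OF st(1,2)] st(3) by (simp add: field_simps)
    then show ?thesis using \<open>B \<ge> 0\<close> by (simp add: add_increasing2)
  next
    case False
    then have "norm (R s t) / \<bar>t - s\<bar> powr \<eta> \<le> B / h powr \<eta>"
      using bd[OF st(1,2)] \<open>h > 0\<close> \<open>\<eta> > 0\<close> \<open>B \<ge> 0\<close> by (intro frac_le powr_mono2) auto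
    then show ?thesis using \<open>C \<ge> 0\<close> by simp
  qed
qed

lemma two_param_holder_spaceI:
  assumes "continuous_on (K \<times> K) (\<lambda>(s, t). R s t)"
    and bd: "\<And>s t. s \<in> K \<Longrightarrow> t \<in> K \<Longrightarrow> norm (R s t) \<le> B" and "h > 0" "\<eta> > 0" "C \<ge> 0"
    and loc: "\<And>s t. s \<in> K \<Longrightarrow> t \<in> K \<Longrightarrow> \<bar>t - s\<bar> \<le> h \<Longrightarrow> norm (R s t) \<le> C * \<bar>t - s\<bar> powr \<eta>"
  shows "R \<in> two_param_holder_space \<eta> K"
proof -
  have "R t t = 0" if "t \<in> K" for t using loc[OF that that] \<open>h > 0\<close> by simp
  moreover have "bounded ((\<lambda>(s, t). R s t) ` (K \<times> K))"
    using bd by (auto simp: bounded_iff)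
  ultimately show ?thesis
    using assms(1) local_holder_imp_bdd_above[OF bd assms(3-5) loc]
    by (auto simp: two_param_holder_space_def)
qed

lemma local_holder_imp_uniformly_continuous_on:
  fixes f :: "real \<Rightarrow> 'a::real_normed_vector"
  assumes "h > 0" "\<eta> > 0" "C \<ge> 0"
    and loc: "\<And>s t. s \<in> K \<Longrightarrow> t \<in> K \<Longrightarrow> \<bar>t - s\<bar> \<le> h \<Longrightarrow> norm (f t - f s) \<le> C * \<bar>t - s\<bar> powr \<eta>"
  shows "uniformly_continuous_on K f"
  unfolding uniformly_continuous_on_def
proof (intro allI impI)
  fix e :: real assume "e > 0"
  define d where "d = min h ((e / (C + 1)) powr (1 / \<eta>))"
  have "d > 0" using assms \<open>e > 0\<close> by (simp add: d_def)
  moreover have "dist (f t) (f s) < e" if st: "s \<in> K" "t \<in> K" and d: "dist t s < d" for s t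
  proof -
    have "\<bar>t - s\<bar> powr \<eta> \<le> ((e / (C + 1)) powr (1 / \<eta>)) powr \<eta>"
      using d \<open>\<eta> > 0\<close> by (intro powr_mono2) (auto simp: d_def dist_real_def)
    also have "\<dots> = e / (C + 1)" using \<open>\<eta> > 0\<close> \<open>e > 0\<close> \<open>C \<ge> 0\<close> by (simp add: powr_powr)
    finally have "C * \<bar>t - s\<bar> powr \<eta> \<le> C * (e / (C + 1))" using \<open>C \<ge> 0\<close> by (rule mult_left_mono)
    also have "\<dots> < e" using \<open>C \<ge> 0\<close> \<open>e > 0\<close> by (simp add: field_simps)
    finally show ?thesis using loc[OF st] d by (simp add: dist_norm d_def)
  qed
  ultimately show "\<exists>d>0. \<forall>x\<in>K. \<forall>x'\<in>K. dist x' x < d \<longrightarrow> dist (f x') (f x) < e" by blast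
qed

lemma holder_spaceI:
  fixes f :: "real \<Rightarrow> 'a::real_normed_vector"
  assumes bd: "\<And>t. t \<in> K \<Longrightarrow> norm (f t) \<le> B" and "h > 0" "\<eta> > 0" "C \<ge> 0"
    and loc: "\<And>s t. s \<in> K \<Longrightarrow> t \<in> K \<Longrightarrow> \<bar>t - s\<bar> \<le> h \<Longrightarrow> norm (f t - f s) \<le> C * \<bar>t - s\<bar> powr \<eta>"
  shows "f \<in> holder_space \<eta> K"
proof -
  have "norm (f t - f s) \<le> B + B" if "s \<in> K" "t \<in> K" for s t
    using norm_triangle_le_diff[of "f t" "f s" "B + B"] bd[OF that(1)] bd[OF that(2)] by simp
  then have "bdd_above {norm (f t - f s) / \<bar>t - s\<bar> powr \<eta> | s t. s \<in> K \<and> t \<in> K \<and> s \<noteq> t}"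
    using assms(2-5) by (rule local_holder_imp_bdd_above)
  moreover have "continuous_on K f"
    using local_holder_imp_uniformly_continuous_on[OF assms(2-5)] by (simp add: uniformly_continuous_imp_continuous)
  ultimately show ?thesis using bd by (auto simp: holder_space_def bounded_iff)
qed

section \<open>Hoelder vector fields along a rough path\<close>

lemma holder_taylor_bound:
  fixes \<phi> :: "'a::real_normed_vector \<Rightarrow> 'b::real_normed_vector"
  assumes der: "\<And>x. (\<phi> has_derivative blinfun_apply (D x)) (at x)"
    and hol: "\<And>x y. norm (D x - D y) \<le> M * norm (x - y) powr \<delta>" and "\<delta> > 0"
  shows "norm (\<phi> y - \<phi> x - D x (y - x)) \<le> M * norm (y - x) powr (1 + \<delta>)"
proof -
  have "M \<ge> 0 \<or> y = x"
    using order_trans[OF norm_ge_zero hol[of y x]] by (auto simp: zero_le_mult_iff)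
  then consider "y = x" | "M \<ge> 0" by blast
  then show ?thesis
  proof cases
    case 2
    have "norm (\<phi> y - \<phi> x - D x (y - x)) \<le> norm (y - x) * (M * norm (y - x) powr \<delta>)"
    proof (rule differentiable_bound_linearization[where S = "closed_segment x y"])
      show "x + t *\<^sub>R (y - x) \<in> closed_segment x y" if "t \<in> {0..1}" for t
        using that by (auto simp: in_segment algebra_simps intro!: exI[of _ t])
      show "(\<phi> has_derivative blinfun_apply (D z)) (at z within closed_segment x y)" for z
        by (rule has_derivative_at_withinI[OF der])
      fix z assume z: "z \<in> closed_segment x y"
      have "norm (D z - D x) \<le> M * norm (z - x) powr \<delta>" by (rule hol)
      also have "\<dots> \<le> M * norm (y - x) powr \<delta>"
        using z 2 \<open>\<delta> > 0\<close> segment_bound1[OF z] by (intro mult_left_mono powr_mono2) auto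
      finally show "onorm (blinfun_apply (D z) - blinfun_apply (D x)) \<le> M * norm (y - x) powr \<delta>"
        by (simp add: norm_blinfun.rep_eq minus_blinfun.rep_eq fun_diff_def)
    qed auto
    then show ?thesis by (cases "y = x") (simp_all add: powr_add mult_ac)
  qed simp
qed

text \<open>
  One constant \<open>M\<close> bounds all the data, and the estimates below depend on the driver only through
  \<open>M\<close>; they therefore apply unchanged to the time-reversed driver.
\<close>

locale rough_equation =
  fixes \<phi> :: "real ^ 'n \<Rightarrow> (real ^ 'n) \<Rightarrow>\<^sub>L (real ^ 'n)"
    and X :: "real \<Rightarrow> real ^ 'n" and XX :: "real \<Rightarrow> real \<Rightarrow> real ^ 'n ^ 'n"
    and J :: "real set" and \<gamma> \<delta> M :: real
  assumes \<gamma>_pos: "\<gamma> > 0" and \<delta>_pos: "\<delta> > 0" and \<delta>_less_1: "\<delta> < 1"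
    and exponent_gt_1: "(2 + \<delta>) * \<gamma> > 1"
    and M_ge_1: "M \<ge> 1"
    and norm_contract: "\<And>(B :: (real ^ 'n) \<Rightarrow>\<^sub>L (real ^ 'n) \<Rightarrow>\<^sub>L (real ^ 'n)) A.
          norm (contract B A) \<le> M * norm B * norm A"
    and field_deriv: "\<And>x. (\<phi> has_derivative total_derivative \<phi> x) (at x)"
    and norm_field: "\<And>x. norm (\<phi> x) \<le> M"
    and norm_field_deriv: "\<And>x. norm (total_derivative \<phi> x) \<le> M"
    and field_deriv_holder:
      "\<And>x y. norm (total_derivative \<phi> x - total_derivative \<phi> y) \<le> M * norm (x - y) powr \<delta>"
    and norm_X: "\<And>s t. s \<in> J \<Longrightarrow> t \<in> J \<Longrightarrow> norm (increment X s t) \<le> M * \<bar>t - s\<bar> powr \<gamma>"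
    and norm_XX: "\<And>s t. s \<in> J \<Longrightarrow> t \<in> J \<Longrightarrow> norm (XX s t) \<le> M * \<bar>t - s\<bar> powr (2 * \<gamma>)"
    and chen: "\<And>s u t \<mu> \<nu>. s \<in> J \<Longrightarrow> u \<in> J \<Longrightarrow> t \<in> J \<Longrightarrow>
          additivity_defect XX s u t $ \<mu> $ \<nu> = increment X s u $ \<mu> * increment X u t $ \<nu>"
begin

text \<open>
  For a path with derivative \<open>Y' = \<phi>(Y)\<close> this is the derivative \<open>W'\<close> of \<open>W = \<phi>(Y)\<close>.
\<close>

definition second_field :: "real ^ 'n \<Rightarrow> (real ^ 'n) \<Rightarrow>\<^sub>L (real ^ 'n) \<Rightarrow>\<^sub>L (real ^ 'n)" where
  "second_field x = total_derivative \<phi> x o\<^sub>L \<phi> x"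

definition expansion_error :: "(real \<Rightarrow> real ^ 'n) \<Rightarrow> real \<Rightarrow> real \<Rightarrow> real ^ 'n" where
  "expansion_error Y s t =
     increment Y s t - rough_germ X XX (\<lambda>r. \<phi> (Y r)) (\<lambda>r. second_field (Y r)) s t"

lemma time_reversal:
  "rough_equation \<phi> (\<lambda>t. X (- t)) (\<lambda>s t. XX (- s) (- t)) (uminus ` J) \<gamma> \<delta> M"
proof
  fix s t assume "s \<in> uminus ` J" "t \<in> uminus ` J"
  then have st: "- s \<in> J" "- t \<in> J" by auto
  show "norm (increment (\<lambda>t. X (- t)) s t) \<le> M * \<bar>t - s\<bar> powr \<gamma>"
    using norm_X[OF st] by (simp add: increment_def abs_minus_commute)
  show "norm (XX (- s) (- t)) \<le> M * \<bar>t - s\<bar> powr (2 * \<gamma>)"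
    using norm_XX[OF st] by (simp add: abs_minus_commute)
next
  fix s u t \<mu> \<nu> assume "s \<in> uminus ` J" "u \<in> uminus ` J" "t \<in> uminus ` J"
  then have "- s \<in> J" "- u \<in> J" "- t \<in> J" by auto
  then show "additivity_defect (\<lambda>s t. XX (- s) (- t)) s u t $ \<mu> $ \<nu>
      = increment (\<lambda>t. X (- t)) s u $ \<mu> * increment (\<lambda>t. X (- t)) u t $ \<nu>"
    using chen[of "- s" "- u" "- t" \<mu> \<nu>] by (simp add: additivity_defect_def increment_def)
qed (fact \<gamma>_pos \<delta>_pos \<delta>_less_1 exponent_gt_1 M_ge_1 norm_contract field_deriv norm_field
      norm_field_deriv field_deriv_holder)+

lemma norm_second_field: "norm (second_field x) \<le> M * M"
proof -
  have "norm (second_field x) \<le> norm (total_derivative \<phi> x) * norm (\<phi> x)"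
    unfolding second_field_def by (rule norm_blinfun_compose)
  also have "\<dots> \<le> M * M"
    using norm_field norm_field_deriv M_ge_1 by (intro mult_mono) auto
  finally show ?thesis .
qed

lemma field_lipschitz: "norm (\<phi> x - \<phi> y) \<le> M * norm (x - y)"
  by (rule differentiable_bound[where S = UNIV and f' = "\<lambda>x. blinfun_apply (total_derivative \<phi> x)"])
     (use field_deriv norm_field_deriv in \<open>auto simp flip: norm_blinfun.rep_eq\<close>)

lemma continuous_field: "continuous_on S \<phi>"
  using field_deriv has_derivative_continuous
  by (metis continuous_at_imp_continuous_on)

lemma norm_second_field_diff:
  "norm (second_field x - second_field y) \<le> M * M * (norm (x - y) powr \<delta> + norm (x - y))"
proof -
  have "second_field x - second_field y
      = ((total_derivative \<phi> x - total_derivative \<phi> y) o\<^sub>L \<phi> x)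
        + (total_derivative \<phi> y o\<^sub>L (\<phi> x - \<phi> y))"
    by (simp add: second_field_def bounded_bilinear.diff_left[OF bounded_bilinear_blinfun_compose]
         bounded_bilinear.diff_right[OF bounded_bilinear_blinfun_compose])
  then have "norm (second_field x - second_field y)
      \<le> norm (total_derivative \<phi> x - total_derivative \<phi> y) * norm (\<phi> x)
        + norm (total_derivative \<phi> y) * norm (\<phi> x - \<phi> y)"
    by (simp only:) (intro norm_triangle_mono norm_blinfun_compose)
  also have "\<dots> \<le> (M * norm (x - y) powr \<delta>) * M + M * (M * norm (x - y))"
    using norm_field norm_field_deriv field_deriv_holder field_lipschitz M_ge_1
    by (intro add_mono mult_mono) auto
  finally show ?thesis by (simp add: algebra_simps)
qed

lemma continuous_second_field: "continuous_on S second_field"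
proof -
  have "isCont second_field x" for x
  proof -
    have "((\<lambda>z. M * M * (norm (z - x) powr \<delta> + norm (z - x))) \<longlongrightarrow> M * M * (norm (x - x) powr \<delta> + norm (x - x))) (at x)"
      using \<delta>_pos by (intro tendsto_intros tendsto_powr') auto
    then have lim: "((\<lambda>z. M * M * (norm (z - x) powr \<delta> + norm (z - x))) \<longlongrightarrow> 0) (at x)"
      by simp
    have "((\<lambda>z. second_field z - second_field x) \<longlongrightarrow> 0) (at x)"
      by (rule Lim_null_comparison[OF always_eventually lim]) (use norm_second_field_diff in blast)
    then show ?thesis
      unfolding isCont_def by (rule LIM_zero_cancel)
  qed
  then show ?thesis by (simp add: continuous_at_imp_continuous_on)
qed

text \<open>
  These constants bound, for a path of small expansion error, its \<open>\<gamma>\<close>-Hoelder quotient, the order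
  \<open>(1 + \<delta>)\<gamma>\<close> remainder of \<open>\<phi>(Y)\<close> as a controlled path, and the defect of additivity of the error.
  They depend on \<open>M\<close> alone, and not on the path or on the set of times.
\<close>

definition path_const :: real where "path_const = M\<^sup>2 + M ^ 4 + 1"
definition remainder_const :: real where "remainder_const = M * path_const\<^sup>2 + M ^ 5 + M"
definition defect_const :: real where
  "defect_const = remainder_const * M + 2 * M ^ 4 * path_const\<^sup>2"

lemma path_const_ge_1: "path_const \<ge> 1"
  by (simp add: path_const_def)

lemma consts_nonneg: "remainder_const \<ge> 0" "defect_const \<ge> 0"
  using M_ge_1 path_const_ge_1 by (simp_all add: remainder_const_def defect_const_def)

lemma expansion_error_same: "s \<in> J \<Longrightarrow> expansion_error Y s s = 0"
  using norm_XX[of s s]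
  by (simp add: expansion_error_def rough_germ_def increment_def blinfun.zero_right
      bounded_bilinear.zero_right[OF bounded_bilinear_contract])

text \<open>
  In the following estimates the error on \<open>[s, u]\<close> is only assumed to be of order \<open>2\<gamma>\<close> with constant
  \<open>1\<close>. This weak assumption is what allows the constants to be fixed before the constant \<open>L\<close> in
  the bound of order \<open>\<theta>\<close> is chosen. The distance is replaced by an upper bound \<open>d\<close> so that
  intervals of different lengths can be compared.
\<close>

context
  fixes Y :: "real \<Rightarrow> real ^ 'n" and s u d :: real
  assumes su: "s \<in> J" "u \<in> J" and d: "\<bar>u - s\<bar> \<le> d" "d \<le> 1"
    and err: "norm (expansion_error Y s u) \<le> \<bar>u - s\<bar> powr (2 * \<gamma>)"
begin

lemma d_nonneg: "0 \<le> d" using d by simp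

lemma first_order_error:
  "norm (increment Y s u - \<phi> (Y s) (increment X s u)) \<le> (M ^ 4 + 1) * d powr (2 * \<gamma>)"
proof -
  have "norm (contract (second_field (Y s)) (XX s u)) \<le> M * norm (second_field (Y s)) * norm (XX s u)"
    by (rule norm_contract)
  also have "\<dots> \<le> M * (M * M) * (M * \<bar>u - s\<bar> powr (2 * \<gamma>))"
    using norm_second_field norm_XX[OF su] M_ge_1 by (intro mult_mono) auto
  finally have "norm (contract (second_field (Y s)) (XX s u)) \<le> M ^ 4 * \<bar>u - s\<bar> powr (2 * \<gamma>)"
    by (simp add: power4_eq_xxxx mult_ac)
  moreover have "increment Y s u - \<phi> (Y s) (increment X s u)
      = expansion_error Y s u + contract (second_field (Y s)) (XX s u)"
    by (simp add: expansion_error_def rough_germ_def)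
  ultimately have "norm (increment Y s u - \<phi> (Y s) (increment X s u))
      \<le> \<bar>u - s\<bar> powr (2 * \<gamma>) + M ^ 4 * \<bar>u - s\<bar> powr (2 * \<gamma>)"
    using err by (simp only:) (intro norm_triangle_mono)
  also have "\<dots> = (M ^ 4 + 1) * \<bar>u - s\<bar> powr (2 * \<gamma>)"
    by (simp add: algebra_simps)
  also have "\<dots> \<le> (M ^ 4 + 1) * d powr (2 * \<gamma>)"
    using d \<gamma>_pos M_ge_1 by (intro mult_left_mono powr_mono2) auto
  finally show ?thesis .
qed

lemma path_increment: "norm (increment Y s u) \<le> path_const * d powr \<gamma>"
proof -
  have "norm (\<phi> (Y s) (increment X s u)) \<le> norm (\<phi> (Y s)) * norm (increment X s u)"
    by (rule norm_blinfun)
  also have "\<dots> \<le> M * (M * d powr \<gamma>)"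
  proof (intro mult_mono norm_field)
    have "\<bar>u - s\<bar> powr \<gamma> \<le> d powr \<gamma>" using d \<gamma>_pos by (intro powr_mono2) auto
    then show "norm (increment X s u) \<le> M * d powr \<gamma>"
      using norm_X[OF su] M_ge_1 by (meson order_trans mult_left_mono zero_le_one)
  qed (use M_ge_1 in auto)
  finally have "norm (\<phi> (Y s) (increment X s u)) \<le> M\<^sup>2 * d powr \<gamma>"
    by (simp add: power2_eq_square mult_ac)
  moreover have "(M ^ 4 + 1) * d powr (2 * \<gamma>) \<le> (M ^ 4 + 1) * d powr \<gamma>"
    using d d_nonneg \<gamma>_pos M_ge_1 by (intro mult_left_mono powr_mono') auto
  ultimately have "norm (increment Y s u) \<le> (M ^ 4 + 1) * d powr \<gamma> + M\<^sup>2 * d powr \<gamma>"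
    using first_order_error
      norm_triangle_ineq[of "increment Y s u - \<phi> (Y s) (increment X s u)" "\<phi> (Y s) (increment X s u)"]
    by simp
  then show ?thesis by (simp add: path_const_def algebra_simps)
qed

lemma path_increment_powr:
  assumes "0 < p" "p \<le> 2"
  shows "norm (increment Y s u) powr p \<le> path_const\<^sup>2 * d powr (p * \<gamma>)"
proof -
  have "norm (increment Y s u) powr p \<le> (path_const * d powr \<gamma>) powr p"
    using path_increment assms by (intro powr_mono2) auto
  also have "\<dots> = path_const powr p * d powr (p * \<gamma>)"
    using path_const_ge_1 d_nonneg by (simp add: powr_mult powr_powr mult.commute)
  also have "\<dots> \<le> path_const powr 2 * d powr (p * \<gamma>)"
    using assms path_const_ge_1 by (intro mult_right_mono powr_mono) auto
  finally show ?thesis using path_const_ge_1 by simp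
qed

lemma field_increment: "norm (increment (\<lambda>r. \<phi> (Y r)) s u) \<le> M * path_const * d powr \<gamma>"
proof -
  have "norm (increment (\<lambda>r. \<phi> (Y r)) s u) \<le> M * norm (increment Y s u)"
    unfolding increment_def by (rule field_lipschitz)
  also have "\<dots> \<le> M * (path_const * d powr \<gamma>)"
    using path_increment M_ge_1 by (intro mult_left_mono) auto
  finally show ?thesis by (simp add: mult_ac)
qed

lemma second_field_increment:
  "norm (increment (\<lambda>r. second_field (Y r)) s u) \<le> 2 * M\<^sup>2 * path_const\<^sup>2 * d powr (\<delta> * \<gamma>)"
proof -
  have "norm (increment Y s u) powr \<delta> \<le> path_const\<^sup>2 * d powr (\<delta> * \<gamma>)"
    using \<delta>_pos \<delta>_less_1 by (intro path_increment_powr) auto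
  moreover have "norm (increment Y s u) \<le> path_const\<^sup>2 * d powr (\<delta> * \<gamma>)"
  proof -
    have "path_const * d powr \<gamma> \<le> path_const\<^sup>2 * d powr (\<delta> * \<gamma>)"
      using path_const_ge_1 d d_nonneg \<delta>_less_1 \<gamma>_pos
      by (intro mult_mono powr_mono') (auto simp: power2_eq_square)
    then show ?thesis using path_increment by linarith
  qed
  ultimately have "M * M * (norm (increment Y s u) powr \<delta> + norm (increment Y s u))
      \<le> M * M * (path_const\<^sup>2 * d powr (\<delta> * \<gamma>) + path_const\<^sup>2 * d powr (\<delta> * \<gamma>))"
    using M_ge_1 by (intro mult_left_mono add_mono) auto
  then show ?thesis
    using norm_second_field_diff[of "Y u" "Y s"]
    by (simp add: increment_def power2_eq_square mult_ac)
qed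

text \<open>
  Replacing \<open>\<delta>Y\<close> by \<open>\<phi>(Y) \<delta>X\<close> in the first order Taylor term of \<open>\<phi>\<close> costs the order \<open>2\<gamma>\<close>, which is
  better than the order \<open>(1 + \<delta>)\<gamma>\<close> of the Taylor remainder.
\<close>

lemma field_remainder:
  "norm (increment (\<lambda>r. \<phi> (Y r)) s u - second_field (Y s) (increment X s u))
    \<le> remainder_const * d powr ((1 + \<delta>) * \<gamma>)"
proof -
  let ?D = "total_derivative \<phi> (Y s)"
  have "norm (\<phi> (Y u) - \<phi> (Y s) - ?D (Y u - Y s)) \<le> M * norm (Y u - Y s) powr (1 + \<delta>)"
    by (rule holder_taylor_bound[OF field_deriv field_deriv_holder \<delta>_pos])
  also have "\<dots> \<le> M * (path_const\<^sup>2 * d powr ((1 + \<delta>) * \<gamma>))"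
    using path_increment_powr[of "1 + \<delta>"] \<delta>_pos \<delta>_less_1 M_ge_1
    by (intro mult_left_mono) (auto simp: increment_def)
  finally have taylor: "norm (increment (\<lambda>r. \<phi> (Y r)) s u - ?D (increment Y s u))
      \<le> M * (path_const\<^sup>2 * d powr ((1 + \<delta>) * \<gamma>))"
    by (simp add: increment_def)
  have "norm (?D (increment Y s u - \<phi> (Y s) (increment X s u)))
      \<le> norm ?D * norm (increment Y s u - \<phi> (Y s) (increment X s u))"
    by (rule norm_blinfun)
  also have "\<dots> \<le> M * ((M ^ 4 + 1) * d powr (2 * \<gamma>))"
    using first_order_error norm_field_deriv M_ge_1 by (intro mult_mono) auto
  also have "\<dots> \<le> M * ((M ^ 4 + 1) * d powr ((1 + \<delta>) * \<gamma>))"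
    using d d_nonneg \<gamma>_pos M_ge_1 \<delta>_less_1 by (intro mult_left_mono powr_mono') auto
  finally have chain: "norm (?D (increment Y s u - \<phi> (Y s) (increment X s u)))
      \<le> M * ((M ^ 4 + 1) * d powr ((1 + \<delta>) * \<gamma>))" .
  have "increment (\<lambda>r. \<phi> (Y r)) s u - second_field (Y s) (increment X s u)
      = (increment (\<lambda>r. \<phi> (Y r)) s u - ?D (increment Y s u))
        + ?D (increment Y s u - \<phi> (Y s) (increment X s u))"
    by (simp add: second_field_def blinfun.diff_right)
  then have "norm (increment (\<lambda>r. \<phi> (Y r)) s u - second_field (Y s) (increment X s u))
      \<le> M * (path_const\<^sup>2 * d powr ((1 + \<delta>) * \<gamma>)) + M * ((M ^ 4 + 1) * d powr ((1 + \<delta>) * \<gamma>))"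
    using taylor chain by (simp only:) (intro norm_triangle_mono)
  also have "\<dots> = remainder_const * d powr ((1 + \<delta>) * \<gamma>)"
    by (simp add: remainder_const_def algebra_simps power_numeral_reduce)
  finally show ?thesis .
qed

text \<open>
  The error is an increment minus a germ, so its defect is that of the germ up to sign. Both terms of
  this defect have order \<open>(2 + \<delta>)\<gamma>\<close>: the first as \<open>(1 + \<delta>)\<gamma> + \<gamma>\<close>, the second as \<open>\<delta>\<gamma> + 2\<gamma>\<close>.
\<close>

lemma expansion_error_almost_additive:
  assumes t: "t \<in> J" "\<bar>t - u\<bar> \<le> d"
  shows "norm (expansion_error Y s t - expansion_error Y s u - expansion_error Y u t)
     \<le> defect_const * d powr ((2 + \<delta>) * \<gamma>)"
proof -
  let ?R = "increment (\<lambda>r. \<phi> (Y r)) s u - second_field (Y s) (increment X s u)"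
  have "expansion_error Y s t - expansion_error Y s u - expansion_error Y u t
      = - additivity_defect (rough_germ X XX (\<lambda>r. \<phi> (Y r)) (\<lambda>r. second_field (Y r))) s u t"
    by (simp add: expansion_error_def additivity_defect_def increment_def)
  also have "\<dots> = ?R (increment X u t) + contract (increment (\<lambda>r. second_field (Y r)) s u) (XX u t)"
    using chen[OF su t(1)] by (simp add: additivity_defect_rough_germ blinfun.minus_left)
  finally have eq: "expansion_error Y s t - expansion_error Y s u - expansion_error Y u t
      = ?R (increment X u t) + contract (increment (\<lambda>r. second_field (Y r)) s u) (XX u t)" .
  have "norm (increment X u t) \<le> M * d powr \<gamma>"
    using norm_X[OF su(2) t(1)] t(2) \<gamma>_pos M_ge_1
    by (elim order_trans) (intro mult_left_mono powr_mono2, auto)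
  then have "norm (?R (increment X u t)) \<le> (remainder_const * d powr ((1 + \<delta>) * \<gamma>)) * (M * d powr \<gamma>)"
    using field_remainder consts_nonneg
    by (intro order_trans[OF norm_blinfun] mult_mono) auto
  also have "\<dots> = remainder_const * M * d powr ((2 + \<delta>) * \<gamma>)"
    by (simp flip: powr_add add: algebra_simps)
  finally have first: "norm (?R (increment X u t)) \<le> remainder_const * M * d powr ((2 + \<delta>) * \<gamma>)" .
  have "norm (XX u t) \<le> M * d powr (2 * \<gamma>)"
    using norm_XX[OF su(2) t(1)] t(2) \<gamma>_pos M_ge_1
    by (elim order_trans) (intro mult_left_mono powr_mono2, auto)
  then have "norm (contract (increment (\<lambda>r. second_field (Y r)) s u) (XX u t))
      \<le> M * (2 * M\<^sup>2 * path_const\<^sup>2 * d powr (\<delta> * \<gamma>)) * (M * d powr (2 * \<gamma>))"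
    using second_field_increment M_ge_1
    by (intro order_trans[OF norm_contract] mult_mono) auto
  also have "\<dots> = 2 * M ^ 4 * path_const\<^sup>2 * d powr ((2 + \<delta>) * \<gamma>)"
    by (simp add: ring_distribs powr_add power_numeral_reduce mult_ac)
  finally have "norm (expansion_error Y s t - expansion_error Y s u - expansion_error Y u t)
      \<le> remainder_const * M * d powr ((2 + \<delta>) * \<gamma>) + 2 * M ^ 4 * path_const\<^sup>2 * d powr ((2 + \<delta>) * \<gamma>)"
    unfolding eq by (rule norm_triangle_mono[OF first])
  then show ?thesis by (simp add: defect_const_def algebra_simps)
qed

end

end

section \<open>Tychonoff compactness and a choice of scale\<close>

text \<open>
  By Tychonoff's theorem the functions with a given pointwise bound form a compact set for pointwise
  convergence, hence closed conditions that are finitely satisfiable there are satisfiable.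
\<close>

lemma pointwise_bounded_fip:
  fixes C :: "'i \<Rightarrow> ('t \<Rightarrow> 'a::{real_normed_vector, heine_borel}) set"
  assumes closed: "\<And>i. i \<in> I \<Longrightarrow> closed (C i)"
    and fin: "\<And>I'. finite I' \<Longrightarrow> I' \<subseteq> I \<Longrightarrow> \<exists>Y. (\<forall>t. norm (Y t) \<le> r t) \<and> (\<forall>i\<in>I'. Y \<in> C i)"
  shows "\<exists>Y. \<forall>i\<in>I. Y \<in> C i"
proof -
  let ?B = "\<Pi>\<^sub>E t\<in>UNIV. cball 0 (r t) :: 'a set"
  have "compactin (product_topology (\<lambda>_. euclidean) UNIV) ?B"
    by (simp add: compactin_PiE)
  then have "compact ?B" by (simp add: euclidean_product_topology)
  then have "?B \<inter> (\<Inter>i\<in>I. C i) \<noteq> {}"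
  proof (rule compact_imp_fip_image)
    fix I' assume I': "finite I'" "I' \<subseteq> I"
    obtain Y where "\<forall>t. norm (Y t) \<le> r t" "\<forall>i\<in>I'. Y \<in> C i" using fin[OF I'] by blast
    then have "Y \<in> ?B \<inter> (\<Inter>i\<in>I'. C i)" by auto
    then show "?B \<inter> (\<Inter>i\<in>I'. C i) \<noteq> {}" by blast
  qed (rule closed)
  then show ?thesis by blast
qed

text \<open>
  At small scales a bound of higher order absorbs its constant. With \<open>a = 2\<gamma>\<close> and \<open>b = \<theta>\<close> this
  turns the bound obtained from Davie's argument into the assumption that the argument needs.
\<close>

lemma powr_absorb_constant:
  fixes a b L h\<^sub>0 :: real
  assumes "a < b" "L \<ge> 0" "h\<^sub>0 > 0"
  obtains h where "0 < h" "h \<le> 1" "h \<le> h\<^sub>0"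
    and "\<And>d. 0 \<le> d \<Longrightarrow> d \<le> h \<Longrightarrow> L * d powr b \<le> d powr a"
proof -
  define h where "h = min (min 1 h\<^sub>0) ((1 / (L + 1)) powr (1 / (b - a)))"
  have "L * d powr b \<le> d powr a" if d: "0 \<le> d" "d \<le> h" for d
  proof -
    have "d powr (b - a) \<le> ((1 / (L + 1)) powr (1 / (b - a))) powr (b - a)"
      using d \<open>a < b\<close> by (intro powr_mono2) (auto simp: h_def)
    also have "\<dots> = 1 / (L + 1)" using \<open>a < b\<close> \<open>L \<ge> 0\<close> by (simp add: powr_powr)
    finally have "L * d powr (b - a) \<le> L * (1 / (L + 1))"
      using \<open>L \<ge> 0\<close> by (rule mult_left_mono)
    also have "\<dots> \<le> 1" using \<open>L \<ge> 0\<close> by simp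
    finally have "L * d powr (b - a) * d powr a \<le> 1 * d powr a" by (rule mult_right_mono) simp
    then show ?thesis by (simp add: mult.assoc flip: powr_add)
  qed
  moreover have "0 < h" "h \<le> 1" "h \<le> h\<^sub>0" using assms by (auto simp: h_def)
  ultimately show ?thesis using that by blast
qed

section \<open>The Davie estimate for Euler schemes\<close>

context rough_equation
begin

lemma expansion_error_cong:
  "Y s = Z s \<Longrightarrow> Y t = Z t \<Longrightarrow> expansion_error Y s t = expansion_error Z s t"
  by (simp add: expansion_error_def increment_def rough_germ_def)

text \<open>
  The induction is on the number of times in \<open>[s, t]\<close>. If \<open>m\<close> is the last time before the midpoint and
  \<open>m'\<close> the next one, then \<open>[s, m]\<close> and \<open>[m', t]\<close> have at most half the length of \<open>[s, t]\<close>, and the Euler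
  step from \<open>m\<close> to \<open>m'\<close> has no error. Hence the error on \<open>[s, t]\<close> is at most \<open>2 L (\<bar>t - s\<bar>/2)\<^sup>\<theta>\<close> plus
  two defects, and \<open>L\<close> is large enough to absorb the latter.
\<close>

lemma davie_estimate:
  assumes F: "finite F" "F \<subseteq> J" and "h \<le> 1" and "L \<ge> 0"
    and small: "\<And>d. 0 \<le> d \<Longrightarrow> d \<le> h \<Longrightarrow> L * d powr ((2 + \<delta>) * \<gamma>) \<le> d powr (2 * \<gamma>)"
    and large: "2 * defect_const \<le> (1 - 2 powr (1 - (2 + \<delta>) * \<gamma>)) * L"
    and euler: "\<And>s t. s \<in> F \<Longrightarrow> t \<in> F \<Longrightarrow> s < t \<Longrightarrow> F \<inter> {s<..<t} = {} \<Longrightarrow> expansion_error Y s t = 0"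
    and st: "s \<in> F" "t \<in> F" "s \<le> t" "t - s \<le> h"
  shows "norm (expansion_error Y s t) \<le> L * (t - s) powr ((2 + \<delta>) * \<gamma>)"
  using st
proof (induction "card (F \<inter> {s..t})" arbitrary: s t rule: less_induct)
  case less
  let ?e = "expansion_error Y" and ?\<theta> = "(2 + \<delta>) * \<gamma>"
  show ?case
  proof (cases "s = t")
    case True
    then show ?thesis using expansion_error_same[of s Y] less.prems F by auto
  next
    case False
    then have "s < t" using less.prems by simp
    define m where "m = Max {u \<in> F. s \<le> u \<and> u \<le> (s + t) / 2}"
    define m' where "m' = Min {u \<in> F. m < u}"
    have "m \<in> {u \<in> F. s \<le> u \<and> u \<le> (s + t) / 2}"
      unfolding m_def using F less.prems \<open>s < t\<close> by (intro Max_in) auto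
    then have m: "m \<in> F" "s \<le> m" "m \<le> (s + t) / 2" by auto
    then have "m < t" using \<open>s < t\<close> by auto
    then have "m' \<in> {u \<in> F. m < u}"
      unfolding m'_def using F less.prems by (intro Min_in) auto
    then have m': "m' \<in> F" "m < m'" by auto
    have "m' \<le> t" unfolding m'_def using F less.prems \<open>m < t\<close> by (intro Min_le) auto
    \<comment> \<open>neighbouring times, between which the scheme makes no error\<close>
    have gap: "F \<inter> {m<..<m'} = {}"
    proof -
      have "m' \<le> u" if "u \<in> F" "m < u" for u
        unfolding m'_def using F that by (intro Min_le) auto
      then show ?thesis by force
    qed
    have "m' > (s + t) / 2"
    proof (rule ccontr)
      assume "\<not> m' > (s + t) / 2"
      then have "m' \<le> m" unfolding m_def using F m m' by (intro Max_ge) auto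
      then show False using m' by simp
    qed
    have IH: "norm (?e a b) \<le> L * (b - a) powr ?\<theta>"
      if "a \<in> F" "b \<in> F" "s \<le> a" "a \<le> b" "b \<le> t" "s < a \<or> b < t" for a b
    proof (rule less.hyps)
      show "card (F \<inter> {a..b}) < card (F \<inter> {s..t})"
      proof (rule psubset_card_mono)
        have "F \<inter> {a..b} \<subseteq> F \<inter> {s..t}" using that by auto
        moreover have "s \<notin> F \<inter> {a..b} \<or> t \<notin> F \<inter> {a..b}" using that(6) by auto
        moreover have "s \<in> F \<inter> {s..t}" "t \<in> F \<inter> {s..t}" using less.prems by auto
        ultimately show "F \<inter> {a..b} \<subset> F \<inter> {s..t}" by blast
      qed (use F in auto)
    qed (use that less.prems in auto)
    have mono: "(b - a) powr ?\<theta> \<le> ((t - s) / 2) powr ?\<theta>" if "a \<le> b" "b - a \<le> (t - s) / 2" for a b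
      using that exponent_gt_1 by (intro powr_mono2) auto
    have half: "norm (?e a b) \<le> L * ((t - s) / 2) powr ?\<theta>"
      if "a \<in> F" "b \<in> F" "s \<le> a" "a \<le> b" "b \<le> t" "b - a \<le> (t - s) / 2" for a b
    proof -
      have "s < a \<or> b < t" using that \<open>s < t\<close> by (cases "s < a") auto
      then show ?thesis
        using IH[of a b] that mono[of a b] mult_left_mono[OF mono[of a b] \<open>L \<ge> 0\<close>] by linarith
    qed
    have add: "norm (?e s b - ?e s a - ?e a b) \<le> defect_const * (t - s) powr ?\<theta>"
      if "a \<in> F" "b \<in> F" "s \<le> a" "a < t" "a \<le> b" "b \<le> t" for a b
    proof (rule expansion_error_almost_additive)
      have "norm (?e s a) \<le> L * (a - s) powr ?\<theta>" using that less.prems by (intro IH) auto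
      also have "\<dots> \<le> (a - s) powr (2 * \<gamma>)" using that less.prems by (intro small) auto
      finally show "norm (?e s a) \<le> \<bar>a - s\<bar> powr (2 * \<gamma>)" using that by simp
    qed (use that less.prems F \<open>h \<le> 1\<close> in auto)
    have "norm (?e s t) \<le> 2 * (L * ((t - s) / 2) powr ?\<theta>) + 2 * (defect_const * (t - s) powr ?\<theta>)"
    proof -
      have e1: "norm (?e s m' - ?e s m) \<le> defect_const * (t - s) powr ?\<theta>"
        using add[of m m'] m m' \<open>m < t\<close> \<open>m' \<le> t\<close> euler[OF m(1) m'(1) m'(2) gap] by simp
      have e2: "norm (?e s t - ?e s m' - ?e m' t) \<le> defect_const * (t - s) powr ?\<theta>"
      \<comment> \<open>if the step across the midpoint ends at \<open>t\<close>, the second split is trivial and the induction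
        hypothesis, which needs a shorter interval, is not available on \<open>[s, m']\<close>\<close>
      proof (cases "m' = t")
        case True
        then show ?thesis
          using expansion_error_same[of t Y] less.prems F consts_nonneg by auto
      next
        case False
        then show ?thesis using add[of m' t] m m' \<open>m' \<le> t\<close> less.prems by simp
      qed
      have e3: "norm (?e s m) \<le> L * ((t - s) / 2) powr ?\<theta>"
        using m \<open>m < t\<close> less.prems by (intro half) (auto simp: field_simps)
      have e4: "norm (?e m' t) \<le> L * ((t - s) / 2) powr ?\<theta>"
        using m m' \<open>m' \<le> t\<close> \<open>m' > (s + t) / 2\<close> less.prems by (intro half) (auto simp: field_simps)
      have "norm (?e s m + (?e s m' - ?e s m) + ?e m' t + (?e s t - ?e s m' - ?e m' t))
          \<le> L * ((t - s) / 2) powr ?\<theta> + defect_const * (t - s) powr ?\<theta>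
            + L * ((t - s) / 2) powr ?\<theta> + defect_const * (t - s) powr ?\<theta>"
        by (intro norm_triangle_mono e1 e2 e3 e4)
      then show ?thesis by simp
    qed
    also have "2 * (L * ((t - s) / 2) powr ?\<theta>) = 2 powr (1 - ?\<theta>) * L * (t - s) powr ?\<theta>"
      using \<open>s < t\<close> by (simp add: powr_divide powr_diff)
    also have "\<dots> + 2 * (defect_const * (t - s) powr ?\<theta>)
        = (2 powr (1 - ?\<theta>) * L + 2 * defect_const) * (t - s) powr ?\<theta>"
      by (simp add: algebra_simps)
    also have "\<dots> \<le> L * (t - s) powr ?\<theta>"
      using large by (intro mult_right_mono) (auto simp: algebra_simps)
    finally show ?thesis .
  qed
qed

lemma euler_scheme:
  assumes "finite F" "\<And>x. x \<in> F \<Longrightarrow> t0 \<le> x"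
  shows "\<exists>Y. Y t0 = y \<and> (\<forall>s\<in>F. \<forall>t\<in>F. s < t \<longrightarrow> F \<inter> {s<..<t} = {} \<longrightarrow> expansion_error Y s t = 0)"
  using assms
proof (induction F rule: finite_linorder_max_induct)
  case empty
  then show ?case by (intro exI[of _ "\<lambda>_. y"]) auto
next
  case (insert b A)
  show ?case
  proof (cases "A = {}")
    case True
    then show ?thesis by (intro exI[of _ "\<lambda>_. y"]) auto
  next
    case False
    obtain Y where Y: "Y t0 = y"
      "\<forall>s\<in>A. \<forall>t\<in>A. s < t \<longrightarrow> A \<inter> {s<..<t} = {} \<longrightarrow> expansion_error Y s t = 0"
      using insert.IH insert.prems by auto
    define m where "m = Max A"
    have m: "m \<in> A" "\<And>x. x \<in> A \<Longrightarrow> x \<le> m" using insert.hyps(1) False by (auto simp: m_def)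
    have b: "b \<notin> A" "t0 \<noteq> b" "m < b" using insert.hyps insert.prems m False by force+
    define Z where "Z = Y(b := Y m + rough_germ X XX (\<lambda>r. \<phi> (Y r)) (\<lambda>r. second_field (Y r)) m b)"
    have "expansion_error Z m b = 0"
      using b by (simp add: expansion_error_def Z_def increment_def rough_germ_def)
    moreover have "expansion_error Z s t = 0"
      if "s \<in> A" "t \<in> A" "s < t" "A \<inter> {s<..<t} = {}" for s t
    proof -
      have "expansion_error Z s t = expansion_error Y s t"
        using that b by (intro expansion_error_cong) (auto simp: Z_def)
      then show ?thesis using Y that by simp
    qed
    moreover have "s = m" if "s \<in> A" "insert b A \<inter> {s<..<b} = {}" for s
      using that m(2)[OF that(1)] m(1) b(3) by fastforce
    ultimately have "\<forall>s\<in>insert b A. \<forall>t\<in>insert b A. s < t \<longrightarrow> insert b A \<inter> {s<..<t} = {} \<longrightarrow>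
        expansion_error Z s t = 0"
      using insert.hyps(2) by (auto dest: less_asym)
    moreover have "Z t0 = y" using Y(1) b by (simp add: Z_def)
    ultimately show ?thesis by blast
  qed
qed

section \<open>Paths with small expansion error\<close>

lemma closed_expansion_error_le:
  "closed {Y. Y t0 = y \<and> norm (expansion_error Y s t) \<le> c}"
proof -
  have coord: "continuous_on UNIV (\<lambda>Y :: real \<Rightarrow> real ^ 'n. Y r)" for r
    by (rule continuous_on_product_coordinates)
  have comp: "continuous_on UNIV (\<lambda>Y :: real \<Rightarrow> real ^ 'n. f (Y r))"
    if "continuous_on UNIV f" for f :: "real ^ 'n \<Rightarrow> 'b::topological_space" and r
    by (rule continuous_on_compose2[OF that coord]) auto
  have "continuous_on UNIV (\<lambda>Y. expansion_error Y s t)"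
    unfolding expansion_error_def rough_germ_def increment_def[where 'a = "real ^ 'n"]
    by (intro continuous_intros coord comp continuous_field continuous_second_field
        bounded_bilinear.continuous_on[OF bounded_bilinear_contract])
  then show ?thesis
    by (intro closed_Collect_conj closed_Collect_eq closed_Collect_le continuous_intros coord) auto
qed

text \<open>
  The conditions are imposed only at times after \<open>t0\<close>, where Euler schemes run. Compactness needs a
  bound at each time that does not depend on the scheme. It comes from adding the grid \<open>t0 + k h\<close> to
  the given finite set of times: by the Davie estimate the path moves by at most
  \<open>path_const\<close> per grid step.
\<close>

lemma forward_path:
  assumes J: "is_interval J" and t0: "t0 \<in> J"
  obtains L h and Y :: "real \<Rightarrow> real ^ 'n" where "0 < h" "L \<ge> 0" "Y t0 = y"
    and "\<And>s t. s \<in> J \<Longrightarrow> t \<in> J \<Longrightarrow> t0 \<le> s \<Longrightarrow> s \<le> t \<Longrightarrow> t - s \<le> h \<Longrightarrow>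
      norm (expansion_error Y s t) \<le> L * (t - s) powr ((2 + \<delta>) * \<gamma>)"
proof -
  let ?\<theta> = "(2 + \<delta>) * \<gamma>"
  define L where "L = 2 * defect_const / (1 - 2 powr (1 - ?\<theta>))"
  have "2 powr (1 - ?\<theta>) < (1::real)"
    using exponent_gt_1 powr_less_cancel_iff[of 2 "1 - ?\<theta>" 0] by simp
  then have "L \<ge> 0" and large: "2 * defect_const \<le> (1 - 2 powr (1 - ?\<theta>)) * L"
    using consts_nonneg by (auto simp: L_def)
  have "2 * \<gamma> < ?\<theta>" using \<gamma>_pos \<delta>_pos by simp
  then obtain h where h: "0 < h" "h \<le> 1"
    and small: "\<And>d. 0 \<le> d \<Longrightarrow> d \<le> h \<Longrightarrow> L * d powr ?\<theta> \<le> d powr (2 * \<gamma>)"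
    using powr_absorb_constant[OF _ \<open>L \<ge> 0\<close> zero_less_one] by blast
  define I where "I = {(s, t). s \<in> J \<and> t \<in> J \<and> t0 \<le> s \<and> s \<le> t \<and> t - s \<le> h}"
  define C where "C = (\<lambda>(s, t). {Y. Y t0 = y \<and> norm (expansion_error Y s t) \<le> L * (t - s) powr ?\<theta>})"
  define r where "r = (\<lambda>t. norm y + real (nat \<lceil>(t - t0) / h\<rceil>) * path_const)"
  have "\<exists>Y. \<forall>i\<in>I. Y \<in> C i"
  proof (rule pointwise_bounded_fip[where r = r])
    show "closed (C i)" for i by (cases i) (simp add: C_def closed_expansion_error_le)
  next
    fix I' assume I': "finite I'" "I' \<subseteq> I"
    define P where "P = insert t0 (fst ` I' \<union> snd ` I')"
    have P: "finite P" "P \<subseteq> J" "\<And>p. p \<in> P \<Longrightarrow> t0 \<le> p"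
      using I' t0 by (fastforce simp: P_def I_def)+
    obtain N :: nat where N: "(Max P - t0) / h \<le> real N" using real_arch_simple by blast
    have PN: "p - t0 \<le> real N * h" if "p \<in> P" for p
    proof -
      have "p \<le> Max P" using P that by simp
      then show ?thesis using N h by (simp add: field_simps)
    qed
    \<comment> \<open>grid points beyond the end of \<open>J\<close> are dropped\<close>
    define F where "F = P \<union> ((\<lambda>k. t0 + real k * h) ` {..N} \<inter> J)"
    have F: "finite F" "F \<subseteq> J" "\<And>p. p \<in> F \<Longrightarrow> t0 \<le> p" "t0 \<in> F"
      using P h by (auto simp: F_def P_def)
    have FN: "p - t0 \<le> real N * h" if "p \<in> F" for p
      using that PN h by (auto simp: F_def)
    obtain Y where Y: "Y t0 = y"
      and euler: "\<forall>s\<in>F. \<forall>t\<in>F. s < t \<longrightarrow> F \<inter> {s<..<t} = {} \<longrightarrow> expansion_error Y s t = 0"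
      using euler_scheme[OF F(1,3)] by blast
    have davie: "norm (expansion_error Y s t) \<le> L * (t - s) powr ?\<theta>"
      if "s \<in> F" "t \<in> F" "s \<le> t" "t - s \<le> h" for s t
      using davie_estimate[OF F(1,2) \<open>h \<le> 1\<close> \<open>L \<ge> 0\<close> small large _ that] euler by blast
    have bound: "norm (Y t - y) \<le> real n * path_const" if "t \<in> F" "t - t0 \<le> real n * h" for n t
      using that
    proof (induction n arbitrary: t)
      case 0
      then have "t = t0" using F(3)[of t] by simp
      then show ?case using Y by simp
    next
      case (Suc n)
      show ?case
      proof (cases "t - t0 \<le> real n * h")
        case True
        then show ?thesis using Suc.IH[of t] Suc.prems path_const_ge_1 by (simp add: algebra_simps)
      next
        case False
        define g where "g = t0 + real n * h"
        have g: "t0 \<le> g" "g \<le> t" "t - g \<le> h" using False Suc.prems h by (auto simp: g_def algebra_simps)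
        have "real n * h < real N * h" using False FN[OF Suc.prems(1)] by linarith
        then have "n \<le> N" using h by simp
        moreover have "g \<in> J" using J t0 F(2) Suc.prems(1) g by (meson mem_is_interval_1_I subsetD)
        ultimately have "g \<in> F" by (auto simp: F_def g_def)
        have "norm (increment Y g t) \<le> path_const * 1 powr \<gamma>"
        proof (rule path_increment)
          have "norm (expansion_error Y g t) \<le> L * (t - g) powr ?\<theta>"
            using davie \<open>g \<in> F\<close> Suc.prems g by blast
          also have "\<dots> \<le> (t - g) powr (2 * \<gamma>)" using g by (intro small) auto
          finally show "norm (expansion_error Y g t) \<le> \<bar>t - g\<bar> powr (2 * \<gamma>)" using g by simp
        qed (use \<open>g \<in> F\<close> F(2) Suc.prems(1) g h in auto)
        moreover have "norm (Y g - y) \<le> real n * path_const"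
          using \<open>g \<in> F\<close> by (intro Suc.IH) (auto simp: g_def)
        moreover have "Y t - y = (Y g - y) + increment Y g t" by (simp add: increment_def)
        ultimately have "norm (Y t - y) \<le> real n * path_const + path_const * 1 powr \<gamma>"
          by (metis norm_triangle_mono)
        then show ?thesis by (simp add: algebra_simps)
      qed
    qed
    \<comment> \<open>the scheme is determined only at the times in \<open>F\<close>; elsewhere any bounded value will do\<close>
    define Z where "Z = (\<lambda>t. if t \<in> F then Y t else y)"
    have "norm (Z t) \<le> r t" for t
    proof (cases "t \<in> F")
      case True
      have "(t - t0) / h \<le> real (nat \<lceil>(t - t0) / h\<rceil>)" by linarith
      then have "norm (Y t - y) \<le> real (nat \<lceil>(t - t0) / h\<rceil>) * path_const"
        using True h by (intro bound) (auto simp: field_simps)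
      then show ?thesis using True norm_triangle_ineq[of y "Y t - y"] by (simp add: Z_def r_def)
    next
      case False
      then show ?thesis using path_const_ge_1 by (simp add: Z_def r_def)
    qed
    moreover have "Z \<in> C (s, t)" if "(s, t) \<in> I'" for s t
    proof -
      have "s \<in> F" "t \<in> F" using that by (force simp: F_def P_def)+
      moreover have "expansion_error Z s t = expansion_error Y s t"
        using calculation by (intro expansion_error_cong) (auto simp: Z_def)
      ultimately show ?thesis
        using davie[of s t] that I'(2) Y F(4) by (auto simp: C_def I_def Z_def)
    qed
    ultimately show "\<exists>Y. (\<forall>t. norm (Y t) \<le> r t) \<and> (\<forall>i\<in>I'. Y \<in> C i)"
      by (intro exI[of _ Z]) auto
  qed
  then obtain Y where Y: "\<forall>i\<in>I. Y \<in> C i" by blast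
  \<comment> \<open>this trivial condition carries the initial value\<close>
  moreover have "(t0, t0) \<in> I" using t0 h by (simp add: I_def)
  ultimately have "Y t0 = y" by (force simp: C_def)
  with h(1) \<open>L \<ge> 0\<close> show ?thesis
    by (rule that) (use Y in \<open>force simp: C_def I_def\<close>)
qed

lemma expansion_error_rev:
  "rough_equation.expansion_error \<phi> (\<lambda>t. X (- t)) (\<lambda>s t. XX (- s) (- t)) Y s t
     = expansion_error (\<lambda>r. Y (- r)) (- s) (- t)"
proof -
  interpret rev: rough_equation \<phi> "\<lambda>t. X (- t)" "\<lambda>s t. XX (- s) (- t)" "uminus ` J" \<gamma> \<delta> M
    by (rule time_reversal)
  show ?thesis
    by (simp add: rev.expansion_error_def expansion_error_def increment_def rough_germ_def)
qed

text \<open>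
  A driver is given for both orders of its time arguments. Almost additivity for \<open>s, t, s\<close>, together
  with \<open>E\<^sub>s\<^sub>s = 0\<close>, compares the errors of the two orders.
\<close>

lemma expansion_error_swap:
  assumes "s \<in> J" "t \<in> J" "\<bar>t - s\<bar> \<le> 1"
    and "norm (expansion_error Y s t) \<le> \<bar>t - s\<bar> powr (2 * \<gamma>)"
  shows "norm (expansion_error Y t s)
    \<le> norm (expansion_error Y s t) + defect_const * \<bar>t - s\<bar> powr ((2 + \<delta>) * \<gamma>)"
proof -
  have "norm (expansion_error Y s s - expansion_error Y s t - expansion_error Y t s)
      \<le> defect_const * \<bar>t - s\<bar> powr ((2 + \<delta>) * \<gamma>)"
    by (rule expansion_error_almost_additive) (use assms in auto)
  then show ?thesis
    using expansion_error_same[OF assms(1), of Y]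
      norm_triangle_ineq4[of "- expansion_error Y s t" "- expansion_error Y s t - expansion_error Y t s"]
    by simp
qed

text \<open>
  The forward path for the driver and the forward path for the time-reversed driver are glued at
  \<open>t0\<close>. Pairs running towards \<open>t0\<close> are reached by swapping, pairs on different sides of \<open>t0\<close> by one
  more use of almost additivity.
\<close>

lemma two_sided_path:
  assumes J: "is_interval J" and t0: "t0 \<in> J"
  obtains L h and Y :: "real \<Rightarrow> real ^ 'n" where "0 < h" "h \<le> 1" "L \<ge> 0" "Y t0 = y"
    and "\<And>s t. s \<in> J \<Longrightarrow> t \<in> J \<Longrightarrow> \<bar>t - s\<bar> \<le> h \<Longrightarrow>
      norm (expansion_error Y s t) \<le> L * \<bar>t - s\<bar> powr ((2 + \<delta>) * \<gamma>)"
    and "\<And>s t. s \<in> J \<Longrightarrow> t \<in> J \<Longrightarrow> \<bar>t - s\<bar> \<le> h \<Longrightarrow>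
      norm (expansion_error Y s t) \<le> \<bar>t - s\<bar> powr (2 * \<gamma>)"
proof -
  let ?\<theta> = "(2 + \<delta>) * \<gamma>"
  interpret rev: rough_equation \<phi> "\<lambda>t. X (- t)" "\<lambda>s t. XX (- s) (- t)" "uminus ` J" \<gamma> \<delta> M
    by (rule time_reversal)
  obtain L\<^sub>1 h\<^sub>1 Y\<^sub>1 where Y1: "0 < h\<^sub>1" "L\<^sub>1 \<ge> 0" "Y\<^sub>1 t0 = y"
    and f: "\<And>s t. s \<in> J \<Longrightarrow> t \<in> J \<Longrightarrow> t0 \<le> s \<Longrightarrow> s \<le> t \<Longrightarrow> t - s \<le> h\<^sub>1 \<Longrightarrow>
      norm (expansion_error Y\<^sub>1 s t) \<le> L\<^sub>1 * (t - s) powr ?\<theta>"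
    by (rule forward_path[OF J t0, where y = y]) (rule that)
  have "is_interval (uminus ` J)" using J by (simp add: is_interval_neg_translationI)
  moreover have "- t0 \<in> uminus ` J" using t0 by simp
  ultimately obtain L\<^sub>2 h\<^sub>2 Y\<^sub>2 where Y2: "0 < h\<^sub>2" "L\<^sub>2 \<ge> 0" "Y\<^sub>2 (- t0) = y"
    and b: "\<And>s t. s \<in> uminus ` J \<Longrightarrow> t \<in> uminus ` J \<Longrightarrow> - t0 \<le> s \<Longrightarrow> s \<le> t \<Longrightarrow> t - s \<le> h\<^sub>2 \<Longrightarrow>
      norm (rev.expansion_error Y\<^sub>2 s t) \<le> L\<^sub>2 * (t - s) powr ?\<theta>"
    by (rule rev.forward_path[where y = y]) (rule that)
  define Y where "Y = (\<lambda>t. if t0 \<le> t then Y\<^sub>1 t else Y\<^sub>2 (- t))"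
  have Y_before: "Y r = Y\<^sub>2 (- r)" if "r \<le> t0" for r
    using that Y1(3) Y2(3) by (cases "r = t0") (simp_all add: Y_def)
  define L where "L = max L\<^sub>1 L\<^sub>2"
  \<comment> \<open>the straddling case adds two one-sided errors and one defect, each at most \<open>L + defect_const\<close>\<close>
  define L' where "L' = 3 * (L + defect_const)"
  have "L \<ge> 0" "L' \<ge> 0" "L + defect_const \<le> L'"
    using Y1 consts_nonneg by (auto simp: L_def L'_def)
  have "2 * \<gamma> < ?\<theta>" using \<gamma>_pos \<delta>_pos by simp
  moreover have "min h\<^sub>1 h\<^sub>2 > 0" using Y1 Y2 by simp
  ultimately obtain h where h: "0 < h" "h \<le> 1" "h \<le> min h\<^sub>1 h\<^sub>2"
    and small: "\<And>d. 0 \<le> d \<Longrightarrow> d \<le> h \<Longrightarrow> L' * d powr ?\<theta> \<le> d powr (2 * \<gamma>)"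
    using powr_absorb_constant[OF _ \<open>L' \<ge> 0\<close> \<open>min h\<^sub>1 h\<^sub>2 > 0\<close>, of "2 * \<gamma>" ?\<theta>] by blast
  have raise: "norm x \<le> L' * \<bar>d\<bar> powr ?\<theta>"
    if "norm x \<le> c * \<bar>d\<bar> powr ?\<theta>" "c \<le> L'" for x :: "real ^ 'n" and c d
    using that mult_right_mono[of c L' "\<bar>d\<bar> powr ?\<theta>"] by simp
  have away: "norm (expansion_error Y s t) \<le> L * \<bar>t - s\<bar> powr ?\<theta>"
    if st: "s \<in> J" "t \<in> J" "\<bar>t - s\<bar> \<le> h" "t0 \<le> s \<and> s \<le> t \<or> s \<le> t0 \<and> t \<le> s" for s t
    using st(4)
  proof
    assume *: "t0 \<le> s \<and> s \<le> t"
    then have "expansion_error Y s t = expansion_error Y\<^sub>1 s t"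
      by (intro expansion_error_cong) (auto simp: Y_def)
    moreover have "norm (expansion_error Y\<^sub>1 s t) \<le> L\<^sub>1 * (t - s) powr ?\<theta>"
      using * st h by (intro f) auto
    moreover have "L\<^sub>1 * (t - s) powr ?\<theta> \<le> L * (t - s) powr ?\<theta>"
      by (intro mult_right_mono) (auto simp: L_def)
    ultimately show ?thesis using * by simp
  next
    assume *: "s \<le> t0 \<and> t \<le> s"
    have "expansion_error Y s t = expansion_error (\<lambda>r. Y\<^sub>2 (- r)) s t"
      using * by (intro expansion_error_cong Y_before) auto
    also have "\<dots> = rev.expansion_error Y\<^sub>2 (- s) (- t)"
      by (simp add: expansion_error_rev)
    also have "norm \<dots> \<le> L\<^sub>2 * (- t - - s) powr ?\<theta>"
      using * st h by (intro b) auto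
    also have "\<dots> \<le> L * (- t - - s) powr ?\<theta>"
      by (intro mult_right_mono) (auto simp: L_def)
    finally show ?thesis using * by simp
  qed
  have one_sided: "norm (expansion_error Y s t) \<le> (L + defect_const) * \<bar>t - s\<bar> powr ?\<theta>"
    if st: "s \<in> J" "t \<in> J" "\<bar>t - s\<bar> \<le> h" "t0 \<le> s \<and> t0 \<le> t \<or> s \<le> t0 \<and> t \<le> t0" for s t
  proof (cases "t0 \<le> s \<and> s \<le> t \<or> s \<le> t0 \<and> t \<le> s")
    case True
    then show ?thesis using away[OF st(1-3)] consts_nonneg by (simp add: algebra_simps add_increasing2)
  next
    case False
    then have "t0 \<le> t \<and> t \<le> s \<or> t \<le> t0 \<and> s \<le> t" using st(4) by auto
    then have ts: "norm (expansion_error Y t s) \<le> L * \<bar>s - t\<bar> powr ?\<theta>"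
      using st by (intro away) (auto simp: abs_minus_commute)
    also have "\<dots> \<le> L' * \<bar>s - t\<bar> powr ?\<theta>"
      using \<open>L + defect_const \<le> L'\<close> consts_nonneg by (intro mult_right_mono) auto
    also have "\<dots> \<le> \<bar>s - t\<bar> powr (2 * \<gamma>)" using st by (intro small) auto
    finally have "norm (expansion_error Y s t)
        \<le> norm (expansion_error Y t s) + defect_const * \<bar>s - t\<bar> powr ?\<theta>"
      using st h by (intro expansion_error_swap) auto
    then show ?thesis using ts by (simp add: algebra_simps abs_minus_commute)
  qed
  have main: "norm (expansion_error Y s t) \<le> L' * \<bar>t - s\<bar> powr ?\<theta>"
    if st: "s \<in> J" "t \<in> J" "\<bar>t - s\<bar> \<le> h" for s t
  proof (cases "t0 \<le> s \<and> t0 \<le> t \<or> s \<le> t0 \<and> t \<le> t0")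
    case True
    then show ?thesis using one_sided[OF st] \<open>L + defect_const \<le> L'\<close> by (intro raise)
  next
    case False
    then have sides: "\<bar>t0 - s\<bar> \<le> \<bar>t - s\<bar>" "\<bar>t - t0\<bar> \<le> \<bar>t - s\<bar>" by auto
    let ?c = "(L + defect_const) * \<bar>t - s\<bar> powr ?\<theta>"
    have mono: "(L + defect_const) * a powr ?\<theta> \<le> ?c" if "0 \<le> a" "a \<le> \<bar>t - s\<bar>" for a
      using that \<open>L \<ge> 0\<close> consts_nonneg exponent_gt_1 by (intro mult_left_mono powr_mono2) auto
    have 1: "norm (expansion_error Y s t0) \<le> (L + defect_const) * \<bar>t0 - s\<bar> powr ?\<theta>"
      using st sides t0 by (intro one_sided) auto
    have 2: "norm (expansion_error Y t0 t) \<le> (L + defect_const) * \<bar>t - t0\<bar> powr ?\<theta>"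
      using st sides t0 by (intro one_sided) auto
    have "norm (expansion_error Y s t - expansion_error Y s t0 - expansion_error Y t0 t)
        \<le> defect_const * \<bar>t - s\<bar> powr ?\<theta>"
    proof (rule expansion_error_almost_additive)
      have "norm (expansion_error Y s t0) \<le> L' * \<bar>t0 - s\<bar> powr ?\<theta>"
        using 1 \<open>L + defect_const \<le> L'\<close> by (rule raise)
      also have "\<dots> \<le> \<bar>t0 - s\<bar> powr (2 * \<gamma>)" using st sides by (intro small) auto
      finally show "norm (expansion_error Y s t0) \<le> \<bar>t0 - s\<bar> powr (2 * \<gamma>)" .
    qed (use st sides t0 h in auto)
    also have "\<dots> \<le> ?c"
      using \<open>L \<ge> 0\<close> by (intro mult_right_mono) auto
    finally have 3: "norm (expansion_error Y s t - expansion_error Y s t0 - expansion_error Y t0 t) \<le> ?c" .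
    have "norm (expansion_error Y s t0) \<le> ?c" "norm (expansion_error Y t0 t) \<le> ?c"
      using 1 2 mono[of "\<bar>t0 - s\<bar>"] mono[of "\<bar>t - t0\<bar>"] sides by auto
    then have "norm ((expansion_error Y s t - expansion_error Y s t0 - expansion_error Y t0 t)
        + expansion_error Y s t0 + expansion_error Y t0 t) \<le> ?c + ?c + ?c"
      using 3 by (intro norm_triangle_mono)
    then show ?thesis by (simp add: L'_def algebra_simps)
  qed
  show ?thesis
  proof (rule that[OF h(1,2) \<open>L' \<ge> 0\<close> _ main])
    show "Y t0 = y" using Y1 by (simp add: Y_def)
    fix s t assume st: "s \<in> J" "t \<in> J" "\<bar>t - s\<bar> \<le> h"
    then show "norm (expansion_error Y s t) \<le> \<bar>t - s\<bar> powr (2 * \<gamma>)"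
      using main[OF st] small[of "\<bar>t - s\<bar>"] by simp
  qed
qed

section \<open>Solutions of the equation\<close>

text \<open>
  The remainders of \<open>Y\<close> and of \<open>\<phi>(Y)\<close> as controlled paths are estimated in terms of the expansion error
  at distance at most \<open>h\<close>, and \<open>Y\<close> is bounded because \<open>K\<close> is; this gives membership in the spaces of
  controlled paths. The expansion error, up to sign, is the remainder that defines the integral of
  \<open>\<phi>(Y)\<close>, and the primitive is \<open>Y\<close> itself.
\<close>

lemma expansion_error_small_imp_solution:
  assumes K: "is_interval K" "bounded K" "K \<subseteq> J" "t0 \<in> K"
    and rough: "rough_path \<gamma> J X XX"
    and h: "0 < h" "h \<le> 1" and "L \<ge> 0"
    and err: "\<And>s t. s \<in> K \<Longrightarrow> t \<in> K \<Longrightarrow> \<bar>t - s\<bar> \<le> h \<Longrightarrow>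
      norm (expansion_error Y s t) \<le> L * \<bar>t - s\<bar> powr ((2 + \<delta>) * \<gamma>)"
    and err': "\<And>s t. s \<in> K \<Longrightarrow> t \<in> K \<Longrightarrow> \<bar>t - s\<bar> \<le> h \<Longrightarrow>
      norm (expansion_error Y s t) \<le> \<bar>t - s\<bar> powr (2 * \<gamma>)"
  shows "rde_solution \<gamma> \<delta> K X XX \<phi> t0 (Y t0) Y (\<lambda>t. \<phi> (Y t))"
proof -
  have inc: "norm (Y t - Y s) \<le> path_const * \<bar>t - s\<bar> powr \<gamma>"
    "norm (\<phi> (Y t) - \<phi> (Y s)) \<le> M * path_const * \<bar>t - s\<bar> powr \<gamma>"
    "norm (second_field (Y t) - second_field (Y s)) \<le> 2 * M\<^sup>2 * path_const\<^sup>2 * \<bar>t - s\<bar> powr (\<delta> * \<gamma>)"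
    "norm (increment Y s t - \<phi> (Y s) (increment X s t)) \<le> (M ^ 4 + 1) * \<bar>t - s\<bar> powr (2 * \<gamma>)"
    "norm (increment (\<lambda>r. \<phi> (Y r)) s t - second_field (Y s) (increment X s t))
      \<le> remainder_const * \<bar>t - s\<bar> powr ((1 + \<delta>) * \<gamma>)"
    if "s \<in> K" "t \<in> K" "\<bar>t - s\<bar> \<le> h" for s t
  proof -
    have *: "s \<in> J" "t \<in> J" "\<bar>t - s\<bar> \<le> \<bar>t - s\<bar>" "\<bar>t - s\<bar> \<le> 1"
      "norm (expansion_error Y s t) \<le> \<bar>t - s\<bar> powr (2 * \<gamma>)"
      using that K h err'[OF that] by auto
    show "norm (Y t - Y s) \<le> path_const * \<bar>t - s\<bar> powr \<gamma>"
      using path_increment[OF *] by (simp add: increment_def)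
    show "norm (\<phi> (Y t) - \<phi> (Y s)) \<le> M * path_const * \<bar>t - s\<bar> powr \<gamma>"
      using field_increment[OF *] by (simp add: increment_def)
    show "norm (second_field (Y t) - second_field (Y s)) \<le> 2 * M\<^sup>2 * path_const\<^sup>2 * \<bar>t - s\<bar> powr (\<delta> * \<gamma>)"
      using second_field_increment[OF *] by (simp add: increment_def)
    show "norm (increment Y s t - \<phi> (Y s) (increment X s t)) \<le> (M ^ 4 + 1) * \<bar>t - s\<bar> powr (2 * \<gamma>)"
      by (rule first_order_error[OF *])
    show "norm (increment (\<lambda>r. \<phi> (Y r)) s t - second_field (Y s) (increment X s t))
      \<le> remainder_const * \<bar>t - s\<bar> powr ((1 + \<delta>) * \<gamma>)"
      by (rule field_remainder[OF *])
  qed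
  have nonneg: "path_const \<ge> 0" "M \<ge> 0" "M * path_const \<ge> 0" "2 * M\<^sup>2 * path_const\<^sup>2 \<ge> 0"
    "M ^ 4 + 1 \<ge> 0" "remainder_const \<ge> 0"
    using M_ge_1 path_const_ge_1 consts_nonneg by auto
  have exps: "\<delta> * \<gamma> > 0" "2 * \<gamma> > 0" "(1 + \<delta>) * \<gamma> > 0" "(2 + \<delta>) * \<gamma> > 0"
    using \<gamma>_pos \<delta>_pos by auto

  have "uniformly_continuous_on K Y"
    using local_holder_imp_uniformly_continuous_on[OF h(1) \<gamma>_pos nonneg(1)] inc(1) by blast
  then have contY: "continuous_on K Y" and "bounded (Y ` K)"
    using K(2) by (auto intro: uniformly_continuous_imp_continuous bounded_uniformly_continuous_image)
  then obtain BY where BY: "\<And>t. t \<in> K \<Longrightarrow> norm (Y t) \<le> BY" by (auto simp: bounded_iff)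
  have "bounded (X ` J)" "continuous_on J X" "bounded ((\<lambda>(s, t). XX s t) ` (J \<times> J))"
    "continuous_on (J \<times> J) (\<lambda>(s, t). XX s t)"
    using rough by (auto simp: rough_path_def holder_space_def two_param_holder_space_def)
  then obtain BX BXX where BX: "\<And>t. t \<in> K \<Longrightarrow> norm (X t) \<le> BX"
    and BXX: "\<And>s t. s \<in> K \<Longrightarrow> t \<in> K \<Longrightarrow> norm (XX s t) \<le> BXX"
    and contX: "continuous_on K X" and contXX: "continuous_on (K \<times> K) (\<lambda>p. XX (fst p) (snd p))"
  proof -
    obtain b where "\<And>t. t \<in> J \<Longrightarrow> norm (X t) \<le> b"
      using \<open>bounded (X ` J)\<close> by (auto simp: bounded_iff)
    moreover obtain b' where "\<And>s t. s \<in> J \<Longrightarrow> t \<in> J \<Longrightarrow> norm (XX s t) \<le> b'"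
      using \<open>bounded ((\<lambda>(s, t). XX s t) ` (J \<times> J))\<close> by (auto simp: bounded_iff)
    moreover have "continuous_on K X"
      using \<open>continuous_on J X\<close> K(3) by (rule continuous_on_subset)
    moreover have "continuous_on (K \<times> K) (\<lambda>p. XX (fst p) (snd p))"
      using \<open>continuous_on (J \<times> J) (\<lambda>(s, t). XX s t)\<close> K(3)
      by (simp add: case_prod_unfold continuous_on_subset Sigma_mono)
    ultimately show ?thesis using K(3) by (intro that[of b b']) auto
  qed

  have cont1: "continuous_on (K \<times> K) (\<lambda>p. f (fst p))" and cont2: "continuous_on (K \<times> K) (\<lambda>p. f (snd p))"
    if "continuous_on K f" for f :: "real \<Rightarrow> 'b::topological_space"
    by (rule continuous_on_compose2[OF that]; auto intro: continuous_intros)+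
  have cont\<phi>: "continuous_on K (\<lambda>t. \<phi> (Y t))" and cont\<psi>: "continuous_on K (\<lambda>t. second_field (Y t))"
    by (rule continuous_on_compose2[OF continuous_field contY subset_UNIV]
        continuous_on_compose2[OF continuous_second_field contY subset_UNIV])+
  note contin = cont1[OF contY] cont2[OF contY] cont1[OF contX] cont2[OF contX] cont1[OF cont\<phi>]
    cont2[OF cont\<phi>] cont1[OF cont\<psi>] contXX

  have inc_le: "norm (increment f s t) \<le> B + B"
    if "\<And>t. t \<in> K \<Longrightarrow> norm (f t) \<le> B" "s \<in> K" "t \<in> K" for f :: "real \<Rightarrow> 'b::real_normed_vector" and B s t
    unfolding increment_def using that by (intro norm_triangle_le_diff add_mono) auto
  have app_le: "norm (blinfun_apply A (increment X s t)) \<le> B * (BX + BX)"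
    if "norm A \<le> B" "s \<in> K" "t \<in> K" for A :: "(real ^ 'n) \<Rightarrow>\<^sub>L 'b::real_normed_vector" and B s t
    using that inc_le[OF BX that(2,3)] order_trans[OF norm_ge_zero that(1)]
    by (intro order_trans[OF norm_blinfun] mult_mono) auto
  have contract_le: "norm (contract (second_field x) (XX s t)) \<le> M * (M * M) * BXX"
    if "s \<in> K" "t \<in> K" for x s t
    using norm_second_field BXX[OF that] nonneg(2)
    by (intro order_trans[OF norm_contract] mult_mono) auto

  have "(Y, \<lambda>t. \<phi> (Y t)) \<in> controlled_paths \<gamma> (2 * \<gamma>) K X"
    unfolding controlled_paths_def mem_Collect_eq prod.case
  proof (intro conjI)
    show "Y \<in> holder_space \<gamma> K"
      by (rule holder_spaceI[OF BY h(1) \<gamma>_pos nonneg(1) inc(1)])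
    have "(\<lambda>t. \<phi> (Y t)) \<in> holder_space \<gamma> K"
      by (rule holder_spaceI[OF norm_field h(1) \<gamma>_pos nonneg(3) inc(2)])
    then show "(\<lambda>t. \<phi> (Y t)) \<in> holder_space (2 * \<gamma> - \<gamma>) K" by simp
    show "(\<lambda>s t. increment Y s t - \<phi> (Y s) (increment X s t)) \<in> two_param_holder_space (2 * \<gamma>) K"
    proof (rule two_param_holder_spaceI[OF _ _ h(1) exps(2) nonneg(5) inc(4)])
      show "continuous_on (K \<times> K) (\<lambda>(s, t). increment Y s t - \<phi> (Y s) (increment X s t))"
        unfolding case_prod_unfold increment_def by (intro continuous_intros contin)
      show "norm (increment Y s t - \<phi> (Y s) (increment X s t)) \<le> (BY + BY) + M * (BX + BX)"
        if "s \<in> K" "t \<in> K" for s t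
        using inc_le[OF BY that] app_le[OF norm_field that] by (intro norm_triangle_le_diff add_mono)
    qed
  qed
  moreover have W: "controlled_compose \<phi> (Y, \<lambda>t. \<phi> (Y t)) = (\<lambda>t. \<phi> (Y t), \<lambda>t. second_field (Y t))"
    by (simp add: controlled_compose_def second_field_def)
  moreover have "(\<lambda>t. \<phi> (Y t), \<lambda>t. second_field (Y t)) \<in> controlled_paths \<gamma> ((1 + \<delta>) * \<gamma>) K X"
    unfolding controlled_paths_def mem_Collect_eq prod.case
  proof (intro conjI)
    show "(\<lambda>t. \<phi> (Y t)) \<in> holder_space \<gamma> K"
      by (rule holder_spaceI[OF norm_field h(1) \<gamma>_pos nonneg(3) inc(2)])
    have "(\<lambda>t. second_field (Y t)) \<in> holder_space (\<delta> * \<gamma>) K"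
      by (rule holder_spaceI[OF norm_second_field h(1) exps(1) nonneg(4) inc(3)])
    then show "(\<lambda>t. second_field (Y t)) \<in> holder_space ((1 + \<delta>) * \<gamma> - \<gamma>) K"
      by (simp add: algebra_simps)
    show "(\<lambda>s t. increment (\<lambda>t. \<phi> (Y t)) s t - second_field (Y s) (increment X s t))
        \<in> two_param_holder_space ((1 + \<delta>) * \<gamma>) K"
    proof (rule two_param_holder_spaceI[OF _ _ h(1) exps(3) nonneg(6) inc(5)])
      show "continuous_on (K \<times> K) (\<lambda>(s, t). increment (\<lambda>t. \<phi> (Y t)) s t - second_field (Y s) (increment X s t))"
        unfolding case_prod_unfold increment_def by (intro continuous_intros contin)
      show "norm (increment (\<lambda>t. \<phi> (Y t)) s t - second_field (Y s) (increment X s t))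
          \<le> (M + M) + M * M * (BX + BX)" if "s \<in> K" "t \<in> K" for s t
        using inc_le[OF norm_field that] app_le[OF norm_second_field that]
        by (intro norm_triangle_le_diff add_mono)
    qed
  qed
  moreover have "rough_integral \<gamma> ((1 + \<delta>) * \<gamma>) K X XX (\<lambda>t. \<phi> (Y t), \<lambda>t. second_field (Y t)) t0 t
      = increment Y t0 t" if "t \<in> K" for t
  proof (rule rough_integral_eqI[OF K(1) _ _ K(4) that])
    let ?G = "rough_germ X XX (\<lambda>t. \<phi> (Y t)) (\<lambda>t. second_field (Y t))"
    have \<theta>: "(1 + \<delta>) * \<gamma> + \<gamma> = (2 + \<delta>) * \<gamma>" by (simp add: algebra_simps)
    show "(1 + \<delta>) * \<gamma> + \<gamma> > 1" unfolding \<theta> by (rule exponent_gt_1)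
    show "(\<lambda>a b. ?G a b - increment Y a b) \<in> two_param_holder_space ((1 + \<delta>) * \<gamma> + \<gamma>) K"
      unfolding \<theta>
    proof (rule two_param_holder_spaceI[OF _ _ h(1) exps(4) \<open>L \<ge> 0\<close>])
      show "continuous_on (K \<times> K) (\<lambda>(s, t). ?G s t - increment Y s t)"
        unfolding case_prod_unfold increment_def rough_germ_def
        by (intro continuous_intros contin bounded_bilinear.continuous_on[OF bounded_bilinear_contract])
      show "norm (?G s t - increment Y s t) \<le> (M * (BX + BX) + M * (M * M) * BXX) + (BY + BY)"
        if "s \<in> K" "t \<in> K" for s t
        unfolding rough_germ_def
        using app_le[OF norm_field that] contract_le[OF that] inc_le[OF BY that]
        by (intro norm_triangle_le_diff norm_triangle_le add_mono)
      show "norm (?G s t - increment Y s t) \<le> L * \<bar>t - s\<bar> powr ((2 + \<delta>) * \<gamma>)"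
        if "s \<in> K" "t \<in> K" "\<bar>t - s\<bar> \<le> h" for s t
        using err[OF that] by (simp add: expansion_error_def norm_minus_commute)
    qed
  qed
  ultimately show ?thesis by (simp add: rde_solution_def increment_def)
qed

end

lemma differentiable_has_total_derivative:
  assumes "f differentiable (at x)"
  shows "(f has_derivative blinfun_apply (total_derivative f x)) (at x)"
proof -
  have D: "(f has_derivative frechet_derivative f (at x)) (at x)"
    using assms by (simp add: frechet_derivative_works)
  then show ?thesis
    using has_derivative_bounded_linear[OF D]
    by (simp add: total_derivative_def bounded_linear_Blinfun_apply)
qed

lemma rough_path_imp_rough_equation:
  fixes \<phi> :: "real ^ 'n \<Rightarrow> (real ^ 'n) \<Rightarrow>\<^sub>L (real ^ 'n)"
  assumes rough: "rough_path \<gamma> J X XX" and \<phi>: "\<phi> \<in> C1_holder_space \<delta>"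
    and exps: "\<gamma> > 0" "0 < \<delta>" "\<delta> < 1" "(2 + \<delta>) * \<gamma> > 1"
  obtains M where "rough_equation \<phi> X XX J \<gamma> \<delta> M"
proof -
  obtain c where c: "\<And>(B :: (real ^ 'n) \<Rightarrow>\<^sub>L (real ^ 'n) \<Rightarrow>\<^sub>L (real ^ 'n)) A.
      norm (contract B A) \<le> norm B * norm A * c"
    using bounded_bilinear.bounded[OF bounded_bilinear_contract] by blast
  obtain a where a: "\<And>x. norm (\<phi> x) \<le> a"
    using \<phi> by (auto simp: C1_holder_space_def bounded_iff)
  obtain b where b: "\<And>x. norm (total_derivative \<phi> x) \<le> b"
    using \<phi> by (auto simp: C1_holder_space_def bounded_iff)
  obtain e where e: "\<And>q. q \<in> {norm (total_derivative \<phi> x - total_derivative \<phi> y) / norm (x - y) powr \<delta>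
       | x y. x \<noteq> y} \<Longrightarrow> q \<le> e"
    using \<phi> unfolding C1_holder_space_def bdd_above_def by blast
  have e: "norm (total_derivative \<phi> x - total_derivative \<phi> y) \<le> e * norm (x - y) powr \<delta>" for x y
  proof (cases "x = y")
    case False
    then have "norm (total_derivative \<phi> x - total_derivative \<phi> y) / norm (x - y) powr \<delta> \<le> e"
      by (intro e) auto
    then show ?thesis using False by (simp add: divide_le_eq)
  qed simp
  have "X \<in> holder_space \<gamma> J" "XX \<in> two_param_holder_space (2 * \<gamma>) J"
    using rough by (auto simp: rough_path_def)
  note X = this
  obtain f where f: "\<And>s t. s \<in> J \<Longrightarrow> t \<in> J \<Longrightarrow> norm (X t - X s) \<le> f * \<bar>t - s\<bar> powr \<gamma>"
    using holder_space_bound[OF X(1)] by blast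
  obtain g where g: "\<And>s t. s \<in> J \<Longrightarrow> t \<in> J \<Longrightarrow> norm (XX s t) \<le> g * \<bar>t - s\<bar> powr (2 * \<gamma>)"
    using two_param_holder_space_bound[OF X(2)] by blast
  define M where "M = 1 + \<bar>a\<bar> + \<bar>b\<bar> + \<bar>c\<bar> + \<bar>e\<bar> + \<bar>f\<bar> + \<bar>g\<bar>"
  have M: "1 \<le> M" "a \<le> M" "b \<le> M" "c \<le> M" "e \<le> M" "f \<le> M" "g \<le> M"
    unfolding M_def by linarith+
  have up: "x \<le> k * z \<Longrightarrow> k \<le> M \<Longrightarrow> 0 \<le> z \<Longrightarrow> x \<le> M * z" for x k z :: real
    by (meson mult_right_mono order_trans)
  have "rough_equation \<phi> X XX J \<gamma> \<delta> M"
  proof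
    fix B :: "(real ^ 'n) \<Rightarrow>\<^sub>L (real ^ 'n) \<Rightarrow>\<^sub>L (real ^ 'n)" and A
    show "norm (contract B A) \<le> M * norm B * norm A"
      using up[of "norm (contract B A)" c "norm B * norm A"] c[of B A] M by (simp add: mult_ac)
  next
    show "(\<phi> has_derivative total_derivative \<phi> x) (at x)" for x
      using \<phi> by (intro differentiable_has_total_derivative) (simp add: C1_holder_space_def)
    show "norm (\<phi> x) \<le> M" "norm (total_derivative \<phi> x) \<le> M" for x
      using a[of x] b[of x] M by linarith+
    show "norm (total_derivative \<phi> x - total_derivative \<phi> y) \<le> M * norm (x - y) powr \<delta>" for x y
      using up[OF e] M by simp
  next
    fix s t assume "s \<in> J" "t \<in> J"
    then show "norm (increment X s t) \<le> M * \<bar>t - s\<bar> powr \<gamma>"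
      and "norm (XX s t) \<le> M * \<bar>t - s\<bar> powr (2 * \<gamma>)"
      using up[OF f] up[OF g] M by (simp_all add: increment_def)
  next
    fix s u t \<mu> \<nu> assume "s \<in> J" "u \<in> J" "t \<in> J"
    then show "additivity_defect XX s u t $ \<mu> $ \<nu> = increment X s u $ \<mu> * increment X u t $ \<nu>"
      using rough by (simp add: rough_path_def)
  qed (use exps M in auto)
  then show ?thesis by (rule that)
qed

(* A bounded interval J is itself one of the intervals K. On an unbounded J a solution need not be
   bounded nor globally Hoelder continuous, and membership in the controlled path space is local. *)
theorem proposition7:
  fixes J :: "real set" and t0 \<gamma> \<delta> :: real and y :: "real ^ 'n"
    and X :: "real \<Rightarrow> real ^ 'n" and XX :: "real \<Rightarrow> real \<Rightarrow> real ^ 'n ^ 'n"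
    and \<phi> :: "real ^ 'n \<Rightarrow> (real ^ 'n) \<Rightarrow>\<^sub>L (real ^ 'n)"
  assumes "is_interval J" and "t0 \<in> J"
    and "rough_path \<gamma> J X XX"
    and "\<gamma> > 1 / 3"
    and "0 < \<delta>" and "\<delta> < 1" and "(2 + \<delta>) * \<gamma> > 1"
    and "\<phi> \<in> C1_holder_space \<delta>"
  shows "\<exists>Y Y'. \<forall>K. is_interval K \<and> bounded K \<and> K \<subseteq> J \<and> t0 \<in> K \<longrightarrow>
           rde_solution \<gamma> \<delta> K X XX \<phi> t0 y Y Y'"
proof -
  obtain M where "rough_equation \<phi> X XX J \<gamma> \<delta> M"
    using rough_path_imp_rough_equation[OF assms(3,8) _ assms(5-7)] assms(4) by auto
  then interpret rough_equation \<phi> X XX J \<gamma> \<delta> M .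
  obtain L h Y where *: "0 < h" "h \<le> 1" "L \<ge> 0" "Y t0 = y"
    and err: "\<And>s t. s \<in> J \<Longrightarrow> t \<in> J \<Longrightarrow> \<bar>t - s\<bar> \<le> h \<Longrightarrow>
      norm (expansion_error Y s t) \<le> L * \<bar>t - s\<bar> powr ((2 + \<delta>) * \<gamma>)"
    and err': "\<And>s t. s \<in> J \<Longrightarrow> t \<in> J \<Longrightarrow> \<bar>t - s\<bar> \<le> h \<Longrightarrow>
      norm (expansion_error Y s t) \<le> \<bar>t - s\<bar> powr (2 * \<gamma>)"
    by (rule two_sided_path[OF assms(1,2), where y = y]) (rule that)
  have "rde_solution \<gamma> \<delta> K X XX \<phi> t0 (Y t0) Y (\<lambda>t. \<phi> (Y t))"
    if "is_interval K" "bounded K" "K \<subseteq> J" "t0 \<in> K" for K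
  proof (rule expansion_error_small_imp_solution[OF that assms(3) *(1-3)])
    fix s t assume st: "s \<in> K" "t \<in> K" "\<bar>t - s\<bar> \<le> h"
    then have "s \<in> J" "t \<in> J" using that(3) by auto
    then show "norm (expansion_error Y s t) \<le> L * \<bar>t - s\<bar> powr ((2 + \<delta>) * \<gamma>)"
      and "norm (expansion_error Y s t) \<le> \<bar>t - s\<bar> powr (2 * \<gamma>)"
      using st(3) by (rule err, rule err')
  qed
  then show ?thesis
    unfolding *(4) by (intro exI[of _ Y] exI[of _ "\<lambda>t. \<phi> (Y t)"]) simp
qed

end
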